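(* Let $\{\mathcal{T}(t)\}_{t\ge 0}$ be the asymmetric telegraph process with velocities $c_1,-c_2$ ($c_1,c_2>0$) and rate $\lambda>0$, and let $t>0$. For every $\beta\in[0,c_1t]$, $$P\Big\{\max_{0\le s\le t}\mathcal{T}(s)<\beta\ \Big|\ V(0)=c_1\Big\}=e^{-\lambda t}\sum_{r=1}^{\infty}I_r\Big(\frac{2\lambda}{c_1+c_2}\sqrt{(c_1t-\beta)(c_2t+\beta)}\Big)\left[\left(\sqrt{\frac{c_2t+\beta}{c_1t-\beta}}\right)^{r}-\left(\frac{c_2}{c_1}\sqrt{\frac{c_1t-\beta}{c_2t+\beta}}\right)^{r}\right],$$ and $$P\Big\{\max_{0\le s\le t}\mathcal{T}(s)=c_1t\ \Big|\ V(0)=c_1\Big\}=e^{-\lambda t}.$$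
   Context: Asymmetric telegraph process: let $c_1,c_2>0$, $\lambda>0$. Let $\{N(t)\}_{t\ge0}$ be a homogeneous Poisson process with rate $\lambda$, and let $V(0)$ be a random variable independent of $N$ with $P\{V(0)=c_1\}=P\{V(0)=-c_2\}=\frac12$. The velocity $V(s)$ takes values in $\{c_1,-c_2\}$, starts at $V(0)$, and switches from one of these two values to the other at each event of $N$, remaining constant between events. The position of the particle is $\mathcal{T}(t)=\int_0^t V(s)\,ds$ (so $\mathcal{T}(0)=0$). $I_r$ is the modified Bessel function $I_r(x)=\sum_{j=0}^{\infty}\left(\frac{x}{2}\right)^{2j+r}\frac{1}{j!\,\Gamma(j+r+1)}$. At the endpoint $\beta=c_1t$ each term of the series is understood as its limit as $\beta\uparrow c_1t$. *)

theory Defs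
  imports "HOL-Probability.Probability"
begin

text \<open>The paths of the process are counting functions (\<open>N t \<omega>\<close> is the number of events in
  \<open>(0, t]\<close>); only times \<open>t \<ge> 0\<close> are relevant. Subtraction on \<^typ>\<open>nat\<close> is harmless
  because the paths are nondecreasing.\<close>

locale poisson_process = prob_space M for M :: "'a measure" +
  fixes N :: "real \<Rightarrow> 'a \<Rightarrow> nat" and l :: real
  assumes rate_pos: "l > 0"
    and random_variable_N: "\<And>t. t \<ge> 0 \<Longrightarrow> random_variable (count_space UNIV) (N t)"
    and N_zero: "\<And>\<omega>. \<omega> \<in> space M \<Longrightarrow> N 0 \<omega> = 0"
    and N_mono: "\<And>\<omega>. \<omega> \<in> space M \<Longrightarrow> mono_on {0..} (\<lambda>t. N t \<omega>)"
    and N_right_continuous: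
      "\<And>\<omega> t. \<omega> \<in> space M \<Longrightarrow> t \<ge> 0 \<Longrightarrow> continuous (at_right t) (\<lambda>s. N s \<omega>)"
    and independent_increments:
      "\<And>(n::nat) ts. 0 \<le> ts 0 \<Longrightarrow> mono_on {..n} ts \<Longrightarrow>
        indep_vars (\<lambda>_. count_space UNIV) (\<lambda>i \<omega>. N (ts (Suc i)) \<omega> - N (ts i) \<omega>) {..<n}"
    and poisson_increments:
      "\<And>s t. 0 \<le> s \<Longrightarrow> s < t \<Longrightarrow>
        distr M (count_space UNIV) (\<lambda>\<omega>. N t \<omega> - N s \<omega>) = measure_pmf (poisson_pmf (l * (t - s)))"

definition switch_velocity :: "real \<Rightarrow> real \<Rightarrow> real \<Rightarrow> real" where
  "switch_velocity c1 c2 v = (if v = c1 then - c2 else c1)"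

definition velocity ::
    "real \<Rightarrow> real \<Rightarrow> (real \<Rightarrow> 'a \<Rightarrow> nat) \<Rightarrow> ('a \<Rightarrow> real) \<Rightarrow> real \<Rightarrow> 'a \<Rightarrow> real" where
  "velocity c1 c2 N V0 s \<omega> = (switch_velocity c1 c2 ^^ N s \<omega>) (V0 \<omega>)"

definition position ::
    "real \<Rightarrow> real \<Rightarrow> (real \<Rightarrow> 'a \<Rightarrow> nat) \<Rightarrow> ('a \<Rightarrow> real) \<Rightarrow> real \<Rightarrow> 'a \<Rightarrow> real" where
  "position c1 c2 N V0 t \<omega> = integral {0..t} (\<lambda>s. velocity c1 c2 N V0 s \<omega>)"

text \<open>The supremum is attained, hence a maximum: see \<open>running_max_attained\<close> below.\<close>

definition running_max ::
    "real \<Rightarrow> real \<Rightarrow> (real \<Rightarrow> 'a \<Rightarrow> nat) \<Rightarrow> ('a \<Rightarrow> real) \<Rightarrow> real \<Rightarrow> 'a \<Rightarrow> real" where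
  "running_max c1 c2 N V0 t \<omega> = (SUP s\<in>{0..t}. position c1 c2 N V0 s \<omega>)"

text \<open>\<open>initial_indep\<close> states that the \<open>\<sigma>\<close>-algebra generated by \<open>V0\<close> is independent of the one
  generated by all \<open>N t\<close>, \<open>t \<ge> 0\<close> (the path of \<open>N\<close> as a random element of a product space);
  \<^const>\<open>prob_space.indep_var\<close> does not apply because the two target types differ.\<close>

locale asymmetric_telegraph = poisson_process M N l
  for M :: "'a measure" and N :: "real \<Rightarrow> 'a \<Rightarrow> nat" and l :: real +
  fixes V0 :: "'a \<Rightarrow> real" and c1 c2 :: real
  assumes c1_pos: "c1 > 0" and c2_pos: "c2 > 0"
    and random_variable_V0: "random_variable borel V0"
    and prob_V0_c1: "\<P>(\<omega> in M. V0 \<omega> = c1) = 1 / 2"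
    and prob_V0_c2: "\<P>(\<omega> in M. V0 \<omega> = - c2) = 1 / 2"
    and initial_indep:
      "indep_set (sets (vimage_algebra (space M) V0 borel))
        (sets (vimage_algebra (space M) (\<lambda>\<omega>. \<lambda>t\<in>{0..}. N t \<omega>)
          (\<Pi>\<^sub>M t\<in>{0..}. count_space UNIV)))"

lemma switch_velocity_funpow_even_odd:
  assumes "v = c1 \<or> v = - c2" "c1 > 0" "c2 > 0"
  shows "(switch_velocity c1 c2 ^^ n) v = (if even n then v else switch_velocity c1 c2 v)"
  using assms by (induction n) (auto simp: switch_velocity_def)

lemma (in asymmetric_telegraph) running_max_attained:
  assumes "\<omega> \<in> space M" "t \<ge> 0"
  shows "\<exists>s\<in>{0..t}. position c1 c2 N V0 s \<omega> = running_max c1 c2 N V0 t \<omega>"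
    and "\<forall>s\<in>{0..t}. position c1 c2 N V0 s \<omega> \<le> running_max c1 c2 N V0 t \<omega>"
proof -
  let ?V = "\<lambda>s. velocity c1 c2 N V0 s \<omega>"
  let ?T = "\<lambda>s. position c1 c2 N V0 s \<omega>"
  have m: "mono_on {0..t} (\<lambda>s. real (N s \<omega>))"
    using N_mono[OF assms(1)] by (auto simp: mono_on_def)
  have "(\<lambda>s. real (N s \<omega>)) \<in> borel_measurable (restrict_space borel {0..t})"
    by (rule borel_measurable_mono_on_fnc[OF m])
  then have "(\<lambda>s. nat \<lfloor>real (N s \<omega>)\<rfloor>) \<in> restrict_space borel {0..t} \<rightarrow>\<^sub>M count_space UNIV"
    by measurable
  then have "(\<lambda>s. (switch_velocity c1 c2 ^^ nat \<lfloor>real (N s \<omega>)\<rfloor>) (V0 \<omega>))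
      \<in> borel_measurable (restrict_space borel {0..t})"
    by (rule measurable_compose[where g = "\<lambda>n. (switch_velocity c1 c2 ^^ n) (V0 \<omega>)"]) simp
  then have meas: "?V \<in> borel_measurable (restrict_space borel {0..t})"
    by (simp add: velocity_def)
  have bound: "\<bar>(switch_velocity c1 c2 ^^ n) (V0 \<omega>)\<bar> \<le> max \<bar>V0 \<omega>\<bar> (max c1 c2)" for n
    using c1_pos c2_pos by (cases n) (auto simp: switch_velocity_def)
  have ind: "(\<lambda>s. indicat_real {0..t} s *\<^sub>R ?V s) \<in> borel_measurable lborel"
    using meas by (simp add: borel_measurable_restrict_space_iff)
  have "set_integrable lborel {0..t} ?V"
    unfolding set_integrable_def
  proof (rule integrableI_bounded_set[where A = "{0..t}" and B = "max \<bar>V0 \<omega>\<bar> (max c1 c2)"])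
    show "AE x in lborel. x \<in> {0..t} \<longrightarrow> norm (indicat_real {0..t} x *\<^sub>R ?V x) \<le> max \<bar>V0 \<omega>\<bar> (max c1 c2)"
      using bound by (auto simp: velocity_def)
  qed (use ind assms(2) in auto)
  then have "?V integrable_on {0..t}"
    by (rule set_borel_integral_eq_integral)
  then have cont: "continuous_on {0..t} ?T"
    unfolding position_def by (rule indefinite_integral_continuous_1)
  obtain s where s: "s \<in> {0..t}" "\<forall>u\<in>{0..t}. ?T u \<le> ?T s"
    using continuous_attains_sup[OF compact_Icc _ cont] assms(2) by auto
  have "running_max c1 c2 N V0 t \<omega> = ?T s"
    unfolding running_max_def using s by (intro cSup_eq_maximum) auto
  with s show "\<exists>s\<in>{0..t}. ?T s = running_max c1 c2 N V0 t \<omega>"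
    and "\<forall>s\<in>{0..t}. ?T s \<le> running_max c1 c2 N V0 t \<omega>" by auto
qed

text \<open>Modified Bessel function of the first kind, of integer order.\<close>

definition bessel_I :: "nat \<Rightarrow> real \<Rightarrow> real" where
  "bessel_I r x = (\<Sum>j. (x / 2) ^ (2 * j + r) * (1 / (fact j * Gamma (real (j + r + 1)))))"

definition series_term_formula :: "real \<Rightarrow> real \<Rightarrow> real \<Rightarrow> real \<Rightarrow> nat \<Rightarrow> real \<Rightarrow> real" where
  "series_term_formula c1 c2 l t r \<beta> =
     bessel_I r (2 * l / (c1 + c2) * sqrt ((c1 * t - \<beta>) * (c2 * t + \<beta>))) *
     (sqrt ((c2 * t + \<beta>) / (c1 * t - \<beta>)) ^ r -
      (c2 / c1 * sqrt ((c1 * t - \<beta>) / (c2 * t + \<beta>))) ^ r)"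

text \<open>The formula divides by zero at the endpoint \<open>\<beta> = c1 * t\<close>, where the term is its left limit.\<close>

definition series_term :: "real \<Rightarrow> real \<Rightarrow> real \<Rightarrow> real \<Rightarrow> nat \<Rightarrow> real \<Rightarrow> real" where
  "series_term c1 c2 l t r \<beta> =
     (if \<beta> = c1 * t then Lim (at_left (c1 * t)) (series_term_formula c1 c2 l t r)
      else series_term_formula c1 c2 l t r \<beta>)"

end

theory Submission
  imports Defs
begin

text \<open>
  Put \<open>r = c2 / c1\<close> and, for a level \<open>b\<close>, \<open>x = (c1 * t - b) / (c1 + c2)\<close> and
  \<open>y = (c2 * t + b) / (c1 + c2)\<close>: a path at height \<open>b\<close> at time \<open>t\<close> has spent time \<open>y\<close> moving up and
  time \<open>x\<close> moving down. In the coordinates \<open>(x, y)\<close> an upward step lowers only \<open>y\<close> and a downward step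
  lowers only \<open>x\<close>, the level \<open>0\<close> is the line \<open>y = r * x\<close>, and levels that cannot be reached have
  \<open>x < 0\<close>.

  Let \<open>exp (- l * t) * l ^ n * F n x y\<close> be the probability that there are \<open>n\<close> events up to \<open>t\<close> and
  that the path that starts upwards stays below \<open>b\<close>, and let \<open>G\<close> be the analogue for a downward start.
  Looking at an infinitesimal first step gives \<open>dF (n + 1) / dy = G n\<close> and \<open>dG (n + 1) / dx = F n\<close>, with
  \<open>F n = 0\<close> on the line \<open>y = r * x\<close> and \<open>G n = y ^ n / n!\<close> at \<open>x = 0\<close>. The solution is a polynomial
  whose coefficient at \<open>x ^ i / i! * y ^ k / k!\<close> depends on \<open>k - i\<close> only: for \<open>F\<close> it is \<open>1\<close>, \<open>0\<close> or
  \<open>- r ^ (i - k)\<close> according as \<open>k - i\<close> is positive, zero or negative, and for \<open>G\<close> the same with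
  \<open>k - i + 1\<close>. Both families are \<open>barrier_poly\<close>; vanishing on the line is the antisymmetry
  \<open>barrier_poly_diagonal\<close>.

  The equations are justified by a time grid. Cut \<open>[0, t]\<close> into \<open>m\<close> cells of length \<open>h\<close>. When no cell
  contains two events, the pattern of cells that contain an event is a list of Booleans, and each list
  with \<open>n\<close> entries \<open>True\<close> has the probability \<open>exp (- l * t) * (l * h) ^ n\<close>. So the probability for the
  grid path is a number of lists, which satisfies a two-term recursion: the finite-difference scheme of
  the equations above. It is consistent to order \<open>h\<^sup>2\<close> and its boundary errors have order \<open>h\<close>, so it
  converges (\<open>walk_error\<close>). The grid maximum differs from the true maximum by at most a constant times
  \<open>h\<close> for a fixed number of events (\<open>grid_max_approx\<close>); squeezing gives \<open>prob_max_event\<close>.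

  Summing over \<open>n\<close> and collecting the terms with a fixed \<open>\<bar>k - i\<bar>\<close> turns the double series into the
  Bessel series (\<open>barrier_series_rearranged\<close>, \<open>series_term_eq\<close>). The initial velocity is
  independent of the events, so conditioning on it fixes the starting direction and nothing else
  (\<open>cond_prob_initial_up\<close>).
\<close>

section \<open>The polynomials\<close>

text \<open>
  For \<open>d \<ge> 0\<close> the weight of \<open>- d\<close> is \<open>- (r ^ d)\<close> times the weight of \<open>d\<close>; this antisymmetry makes
  the polynomials below vanish at the barrier.
\<close>

definition weight :: "real \<Rightarrow> int \<Rightarrow> real" where
  "weight r d = (if d > 0 then 1 else if d = 0 then 0 else - (r ^ nat (- d)))"

text \<open>
  The shift \<open>s\<close> is raised by differentiation in \<open>y\<close> and lowered by differentiation in \<open>x\<close>. Shift \<open>0\<close>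
  belongs to paths that start upwards, shift \<open>1\<close> to paths that start downwards.
\<close>

definition barrier_poly :: "real \<Rightarrow> int \<Rightarrow> nat \<Rightarrow> real \<Rightarrow> real \<Rightarrow> real" where
  "barrier_poly r s n x y =
     (\<Sum>i\<le>n. weight r (int n - 2 * int i + s) * (x ^ i / fact i) * (y ^ (n - i) / fact (n - i)))"

lemma barrier_poly_0 [simp]: "barrier_poly r s 0 x y = weight r s"
  by (simp add: barrier_poly_def)

lemma divided_power_deriv:
  "((\<lambda>y::real. y ^ Suc m / fact (Suc m)) has_real_derivative y ^ m / fact m) (at y)"
  by (rule derivative_eq_intros refl | simp)+

lemma barrier_poly_deriv_y:
  "(barrier_poly r s (Suc n) x has_real_derivative barrier_poly r (s + 1) n x y) (at y)"
proof -
  have *: "barrier_poly r s (Suc n) x = (\<lambda>y. (\<Sum>i\<le>n. weight r (int n - 2 * int i + (s + 1)) *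
      (x ^ i / fact i) * (y ^ Suc (n - i) / fact (Suc (n - i))))
      + weight r (s - int n - 1) * (x ^ Suc n / fact (Suc n)))"
    by (auto simp: barrier_poly_def fun_eq_iff Suc_diff_le algebra_simps intro!: sum.cong)
  show ?thesis
    unfolding * unfolding barrier_poly_def
    by (rule DERIV_cong, rule DERIV_add, rule DERIV_sum, rule DERIV_cmult,
        rule divided_power_deriv, rule DERIV_const) (simp)
qed

lemma barrier_poly_deriv_x:
  "((\<lambda>x. barrier_poly r s (Suc n) x y) has_real_derivative barrier_poly r (s - 1) n x y) (at x)"
proof -
  have *: "(\<lambda>x. barrier_poly r s (Suc n) x y) = (\<lambda>x. (\<Sum>i\<le>n. weight r (int n - 2 * int i + (s - 1)) *
      (y ^ (n - i) / fact (n - i)) * (x ^ Suc i / fact (Suc i)))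
      + weight r (s + int n + 1) * (y ^ Suc n / fact (Suc n)))"
    unfolding barrier_poly_def sum.atMost_Suc_shift
    by (auto simp: fun_eq_iff algebra_simps intro!: sum.cong)
  show ?thesis
    unfolding * unfolding barrier_poly_def
    by (rule DERIV_cong, rule DERIV_add, rule DERIV_sum, rule DERIV_cmult,
        rule divided_power_deriv, rule DERIV_const) (simp add: mult_ac)
qed

lemma barrier_poly_left: "s > 0 \<Longrightarrow> barrier_poly r s n 0 y = y ^ n / fact n"
proof -
  assume "s > 0"
  have "barrier_poly r s n 0 y = (\<Sum>i\<in>{0}. weight r (int n - 2 * int i + s) * (0 ^ i / fact i) * (y ^ (n - i) / fact (n - i)))"
    unfolding barrier_poly_def by (rule sum.mono_neutral_right) auto
  with \<open>s > 0\<close> show ?thesis by (simp add: weight_def)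
qed

lemma barrier_poly_left_0: "barrier_poly r 0 n 0 y = (if n = 0 then 0 else y ^ n / fact n)"
proof -
  have "barrier_poly r 0 n 0 y = (\<Sum>i\<in>{0}. weight r (int n - 2 * int i + 0) * (0 ^ i / fact i) * (y ^ (n - i) / fact (n - i)))"
    unfolding barrier_poly_def by (rule sum.mono_neutral_right) auto
  then show ?thesis by (simp add: weight_def)
qed

text \<open>
  Multiplying by \<open>r ^ (n - i)\<close>, which is what the substitution \<open>y = r * x\<close> produces, makes the weights
  antisymmetric under \<open>i \<mapsto> n - i\<close>.
\<close>

lemma weight_balance: "weight r (int n - 2 * int i) * r ^ (n - i) = - (weight r (2 * int i - int n) * r ^ i)"
  if "i \<le> n"
proof -
  have "r ^ nat (int n - 2 * int i) * r ^ i = r ^ (n - i)" if "2 * i \<le> n"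
    using that by (subst power_add[symmetric]) (auto intro!: arg_cong2[of _ _ _ _ "(^)"])
  moreover have "r ^ nat (2 * int i - int n) * r ^ (n - i) = r ^ i" if "n \<le> 2 * i"
    using that \<open>i \<le> n\<close> by (subst power_add[symmetric]) (auto intro!: arg_cong2[of _ _ _ _ "(^)"])
  ultimately show ?thesis
    by (auto simp: weight_def)
qed

text \<open>
  At the barrier the terms \<open>i\<close> and \<open>n - i\<close> cancel in pairs.
\<close>

lemma barrier_poly_diagonal: "barrier_poly r 0 n x (r * x) = 0"
proof -
  define u where "u i = weight r (int n - 2 * int i) * (x ^ i / fact i) * ((r * x) ^ (n - i) / fact (n - i))" for i
  have "u (n - i) = - u i" if "i \<le> n" for i
  proof -
    have "u i = weight r (int n - 2 * int i) * r ^ (n - i) * (x ^ n / (fact i * fact (n - i)))"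
      using that by (simp add: u_def power_mult_distrib power_add[symmetric])
    moreover have "u (n - i) = weight r (2 * int i - int n) * r ^ i * (x ^ n / (fact i * fact (n - i)))"
      using that power_add[of x "n - i" i]
      by (simp add: u_def power_mult_distrib of_nat_diff mult_ac)
    ultimately show ?thesis using weight_balance[OF that, of r] by simp
  qed
  then have "(\<Sum>i\<le>n. u i) = (\<Sum>i\<le>n. - u i)"
    using sum.atLeastAtMost_rev[of u 0 n] by (simp add: atMost_atLeast0)
  then show ?thesis
    by (simp add: barrier_poly_def u_def sum_negf)
qed

section \<open>Bounds and Taylor estimates\<close>

definition barrier_bound :: "real \<Rightarrow> real \<Rightarrow> int \<Rightarrow> nat \<Rightarrow> real" where
  "barrier_bound r T s n =
     (\<Sum>i\<le>n. \<bar>weight r (int n - 2 * int i + s)\<bar> * (T ^ i / fact i) * (T ^ (n - i) / fact (n - i)))"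

lemma barrier_bound_nonneg: "T \<ge> 0 \<Longrightarrow> barrier_bound r T s n \<ge> 0"
  unfolding barrier_bound_def by (intro sum_nonneg) auto

lemma barrier_poly_bound:
  assumes "x \<in> {0..T}" "y \<in> {0..T}"
  shows "\<bar>barrier_poly r s n x y\<bar> \<le> barrier_bound r T s n"
  unfolding barrier_poly_def barrier_bound_def
  using assms by (intro order_trans[OF sum_abs] sum_mono)
    (auto simp: abs_mult intro!: mult_mono divide_right_mono power_mono)

lemma abs_diff_le_by_deriv:
  fixes f :: "real \<Rightarrow> real"
  assumes "\<And>z. z \<in> S \<Longrightarrow> (f has_real_derivative f' z) (at z)"
    and "\<And>z. z \<in> S \<Longrightarrow> \<bar>f' z\<bar> \<le> B" and "convex S" "a \<in> S" "b \<in> S"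
  shows "\<bar>f b - f a\<bar> \<le> B * \<bar>b - a\<bar>"
  using field_differentiable_bound[of S f f' B b a] assms
  by (auto intro: has_field_derivative_at_within)

text \<open>
  A bound for the partial derivatives of the polynomial of degree \<open>n\<close>: they are polynomials of degree
  \<open>n - 1\<close>, and \<open>0\<close> when \<open>n = 0\<close>. The shift \<open>s\<close> is that of the derivative.
\<close>

primrec slope_bound :: "real \<Rightarrow> real \<Rightarrow> int \<Rightarrow> nat \<Rightarrow> real" where
  "slope_bound r T s 0 = 0"
| "slope_bound r T s (Suc n) = barrier_bound r T s n"

lemma slope_bound_nonneg: "T \<ge> 0 \<Longrightarrow> slope_bound r T s n \<ge> 0"
  by (cases n) (auto intro: barrier_bound_nonneg)

lemma barrier_poly_lipschitz_y:
  assumes "x \<in> {0..T}" "y \<in> {0..T}" "y' \<in> {0..T}"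
  shows "\<bar>barrier_poly r s n x y' - barrier_poly r s n x y\<bar> \<le> slope_bound r T (s + 1) n * \<bar>y' - y\<bar>"
proof (cases n)
  case (Suc m)
  show ?thesis unfolding Suc slope_bound.simps
    by (rule abs_diff_le_by_deriv[where S = "{0..T}" and f' = "barrier_poly r (s + 1) m x"])
      (use assms in \<open>auto intro: barrier_poly_deriv_y barrier_poly_bound\<close>)
qed simp

lemma barrier_poly_lipschitz_x:
  assumes "x \<in> {0..T}" "x' \<in> {0..T}" "y \<in> {0..T}"
  shows "\<bar>barrier_poly r s n x' y - barrier_poly r s n x y\<bar> \<le> slope_bound r T (s - 1) n * \<bar>x' - x\<bar>"
proof (cases n)
  case (Suc m)
  show ?thesis unfolding Suc slope_bound.simps
    by (rule abs_diff_le_by_deriv[where S = "{0..T}" and f' = "\<lambda>x. barrier_poly r (s - 1) m x y"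
          and f = "\<lambda>x. barrier_poly r s (Suc m) x y"])
      (use assms in \<open>auto intro: barrier_poly_deriv_x barrier_poly_bound\<close>)
qed simp

lemma taylor_step:
  fixes f :: "real \<Rightarrow> real"
  assumes "h > 0" and "\<And>z. z \<in> {a..a + h} \<Longrightarrow> (f has_real_derivative f' z) (at z)"
    and "\<And>z. z \<in> {a..a + h} \<Longrightarrow> \<bar>f' z - f' a\<bar> \<le> B * \<bar>z - a\<bar>" and "B \<ge> 0"
  shows "\<bar>f (a + h) - f a - h * f' a\<bar> \<le> B * h\<^sup>2"
proof -
  obtain z where z: "z > a" "z < a + h" "f (a + h) - f a = h * f' z"
    using MVT2[of a "a + h" f f'] assms(1,2) by auto
  have "\<bar>f (a + h) - f a - h * f' a\<bar> = h * \<bar>f' z - f' a\<bar>"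
    using z(3) \<open>h > 0\<close> by (simp add: abs_mult right_diff_distrib[symmetric])
  also have "\<dots> \<le> h * (B * h)"
    using assms(1,4) z(1,2) order_trans[OF assms(3)[of z] mult_left_mono[of "\<bar>z - a\<bar>" h B]]
    by (intro mult_left_mono) auto
  finally show ?thesis by (simp add: power2_eq_square mult_ac)
qed

text \<open>
  These two estimates say that the polynomials satisfy the recursion of the grid walks up to an error of
  order \<open>h\<^sup>2\<close> per step.
\<close>

lemma barrier_poly_taylor_y:
  assumes "x \<in> {0..T}" "y \<ge> 0" "y + h \<le> T" "h > 0"
  shows "\<bar>barrier_poly r s (Suc n) x (y + h) - barrier_poly r s (Suc n) x y
            - h * barrier_poly r (s + 1) n x y\<bar> \<le> slope_bound r T (s + 2) n * h\<^sup>2"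
proof (rule taylor_step[where f = "barrier_poly r s (Suc n) x"])
  fix z assume "z \<in> {y..y + h}"
  then show "\<bar>barrier_poly r (s + 1) n x z - barrier_poly r (s + 1) n x y\<bar>
      \<le> slope_bound r T (s + 2) n * \<bar>z - y\<bar>"
    using assms barrier_poly_lipschitz_y[of x T y z r "s + 1" n] by (auto simp: add.assoc)
qed (use assms in \<open>auto intro: barrier_poly_deriv_y slope_bound_nonneg\<close>)

lemma barrier_poly_taylor_x:
  assumes "x \<ge> 0" "x + h \<le> T" "y \<in> {0..T}" "h > 0"
  shows "\<bar>barrier_poly r s (Suc n) (x + h) y - barrier_poly r s (Suc n) x y
            - h * barrier_poly r (s - 1) n x y\<bar> \<le> slope_bound r T (s - 2) n * h\<^sup>2"
proof (rule taylor_step[where f = "\<lambda>x. barrier_poly r s (Suc n) x y"])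
  fix z assume "z \<in> {x..x + h}"
  then show "\<bar>barrier_poly r (s - 1) n z y - barrier_poly r (s - 1) n x y\<bar>
      \<le> slope_bound r T (s - 2) n * \<bar>z - x\<bar>"
    using assms barrier_poly_lipschitz_x[of x T z y r "s - 1" n] by (auto simp: diff_diff_eq)
qed (use assms in \<open>auto intro: barrier_poly_deriv_x slope_bound_nonneg\<close>)

section \<open>Counting grid walks below a barrier\<close>

text \<open>
  An entry \<open>True\<close> stands for a cell with an event. The velocity in a cell is the one at its left end, so
  an event reverses the direction only from the next cell on.
\<close>

fun stays_below :: "real \<Rightarrow> real \<Rightarrow> bool \<Rightarrow> real \<Rightarrow> bool list \<Rightarrow> bool" where
  "stays_below d1 d2 up b [] = (0 < b)"
| "stays_below d1 d2 up b (e # es) =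
     (0 < b \<and> stays_below d1 d2 (up \<noteq> e) (if up then b - d1 else b + d2) es)"

definition walks :: "real \<Rightarrow> real \<Rightarrow> bool \<Rightarrow> nat \<Rightarrow> nat \<Rightarrow> real \<Rightarrow> bool list set" where
  "walks d1 d2 up n k b =
     {es. length es = k \<and> count_list es True = n \<and> stays_below d1 d2 up b es}"

lemma finite_walks: "finite (walks d1 d2 up n k b)"
  by (rule finite_subset[OF _ finite_lists_length_eq[of UNIV k]]) (auto simp: walks_def)

lemma stays_below_iff:
  "stays_below d1 d2 up b es \<longleftrightarrow> (\<forall>k\<le>length es.
     (\<Sum>i<k. if even (count_list (take i es) True) = up then d1 else - d2) < b)"
proof (induction es arbitrary: up b)
  case (Cons e es)
  let ?s = "\<lambda>up es i. if even (count_list (take i es) True) = up then d1 else - d2"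
  have shift: "(\<Sum>i<Suc k. ?s up (e # es) i) = (if up then d1 else - d2) + (\<Sum>i<k. ?s (up \<noteq> e) es i)" for k
    unfolding sum.lessThan_Suc_shift by (intro arg_cong2[of _ _ _ _ "(+)"] sum.cong) auto
  have split0: "(\<forall>k\<le>Suc m. P k) \<longleftrightarrow> P 0 \<and> (\<forall>k\<le>m. P (Suc k))" for P m
    using All_less_Suc2[of "Suc m" P] by (simp only: less_Suc_eq_le)
  have "(\<forall>k\<le>length (e # es). (\<Sum>i<k. ?s up (e # es) i) < b) \<longleftrightarrow>
     0 < b \<and> (\<forall>k\<le>length es. (\<Sum>i<Suc k. ?s up (e # es) i) < b)"
    unfolding length_Cons split0 by simp
  also have "\<dots> \<longleftrightarrow> stays_below d1 d2 up b (e # es)"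
    unfolding shift by (auto simp: Cons.IH algebra_simps)
  finally show ?case by simp
qed simp

lemma card_walks_Suc:
  "card (walks d1 d2 up n (Suc k) b) = (if 0 < b then
     card (walks d1 d2 up n k (if up then b - d1 else b + d2)) +
     (case n of 0 \<Rightarrow> 0 | Suc n' \<Rightarrow> card (walks d1 d2 (\<not> up) n' k (if up then b - d1 else b + d2))) else 0)"
proof (cases "0 < b")
  case True
  let ?b = "if up then b - d1 else b + d2"
  let ?U = "case n of 0 \<Rightarrow> {} | Suc n' \<Rightarrow> walks d1 d2 (\<not> up) n' k ?b"
  have eq: "walks d1 d2 up n (Suc k) b = (#) False ` walks d1 d2 up n k ?b \<union> (#) True ` ?U"
    using True
    by (auto simp: walks_def length_Suc_conv image_iff split: nat.splits if_splits)
  have fin: "finite ?U" by (auto split: nat.split simp: finite_walks)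
  have "card (walks d1 d2 up n (Suc k) b) = card (walks d1 d2 up n k ?b) + card ?U"
    unfolding eq by (subst card_Un_disjoint) (auto simp: finite_walks fin card_image)
  then show ?thesis using True by (simp split: nat.split)
next
  case False
  then have "walks d1 d2 up n (Suc k) b = {}" by (auto simp: walks_def length_Suc_conv)
  then show ?thesis using False by simp
qed

lemma card_walks_0: "card (walks d1 d2 up n 0 b) = (if 0 < b \<and> n = 0 then 1 else 0)"
proof -
  have "walks d1 d2 up n 0 b = (if 0 < b \<and> n = 0 then {[]} else {})"
    by (auto simp: walks_def)
  then show ?thesis by simp
qed

lemma walks_empty: "b \<le> 0 \<Longrightarrow> card (walks d1 d2 up n k b) = 0"
  by (cases k) (auto simp: card_walks_0 card_walks_Suc)

text \<open>
  A barrier beyond the reach of a walk that never turns leaves only the choice of the event cells.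
\<close>

lemma card_walks_unconstrained:
  assumes "d1 \<ge> 0" "d2 \<ge> 0" "0 < b" "d1 * real k < b"
  shows "card (walks d1 d2 up n k b) = k choose n"
  using assms(3,4)
proof (induction k arbitrary: up n b)
  case (Suc k)
  let ?b = "if up then b - d1 else b + d2"
  have "0 < ?b" "d1 * real k < ?b"
    using Suc.prems assms(1,2) mult_nonneg_nonneg[of d1 "real k"]
    by (auto simp: algebra_simps simp del: mult_nonneg_nonneg)
  from Suc.IH[OF this] show ?case
    using Suc.prems(1) by (auto simp: card_walks_Suc split: nat.split)
qed (auto simp: card_walks_0)

lemma card_walks_unconstrained_down:
  assumes "d1 \<ge> 0" "d2 > 0" "0 < b" "d1 * real k < b + d2"
  shows "card (walks d1 d2 False n (Suc k) b) = Suc k choose n"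
  using assms by (auto simp: card_walks_Suc card_walks_unconstrained split: nat.split)

text \<open>
  This is the boundary value at \<open>x = 0\<close>. The point \<open>y\<close> may be off the grid time \<open>k * h\<close> by one step,
  because a walk that starts downwards is unconstrained as soon as \<open>x < h\<close>.
\<close>

lemma binomial_power_approx:
  assumes "T \<ge> 0"
  shows "\<exists>K\<ge>0. \<forall>h k y. 0 < h \<longrightarrow> h \<le> 1 \<longrightarrow> real k * h \<le> T \<longrightarrow> 0 \<le> y \<longrightarrow> \<bar>real k * h - y\<bar> \<le> h \<longrightarrow>
     \<bar>h ^ n * real (k choose n) - y ^ n / fact n\<bar> \<le> K * h"
proof (induction n)
  case (Suc n)
  then obtain K where K: "K \<ge> 0" "\<And>h k y. 0 < h \<Longrightarrow> h \<le> 1 \<Longrightarrow> real k * h \<le> T \<Longrightarrow> 0 \<le> y \<Longrightarrow>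
     \<bar>real k * h - y\<bar> \<le> h \<Longrightarrow> \<bar>h ^ n * real (k choose n) - y ^ n / fact n\<bar> \<le> K * h" by blast
  show ?case
  proof (intro exI[of _ "K * (T + real n) + (T + 1) ^ n * (1 + real n)"] conjI allI impI)
    fix h y :: real and k :: nat
    assume h: "0 < h" "h \<le> 1" "real k * h \<le> T" "0 \<le> y" "\<bar>real k * h - y\<bar> \<le> h"
    define p where "p = h ^ n * real (k choose n)"
    define e where "e = real k * h - real n * h"
    have rec: "real (Suc n) * (h ^ Suc n * real (k choose Suc n)) = p * e"
    proof -
      have "real (Suc n * (k choose Suc n)) = real ((k - n) * (k choose n))"
        by (simp only: binomial_absorption binomial_absorb_comp)
      also have "\<dots> = (real k - real n) * real (k choose n)"
        by (cases "n \<le> k") (auto simp: of_nat_diff)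
      finally have *: "real (Suc n) * real (k choose Suc n) = (real k - real n) * real (k choose n)"
        by (simp only: of_nat_mult)
      have "real (Suc n) * (h ^ Suc n * real (k choose Suc n)) = h ^ Suc n * (real (Suc n) * real (k choose Suc n))"
        by (simp only: mult_ac)
      also have "\<dots> = p * e" unfolding * by (simp add: p_def e_def algebra_simps)
      finally show ?thesis .
    qed
    have pe: "\<bar>p - y ^ n / fact n\<bar> \<le> K * h" unfolding p_def by (rule K(2)[OF h])
    have e: "\<bar>e\<bar> \<le> T + real n" "\<bar>e - y\<bar> \<le> (1 + real n) * h"
    proof -
      have "real n * h \<le> real n" using h by (simp add: mult_left_le)
      moreover have "0 \<le> real k * h" "0 \<le> real n * h" using h by auto
      moreover note \<open>T \<ge> 0\<close>
      ultimately show "\<bar>e\<bar> \<le> T + real n" "\<bar>e - y\<bar> \<le> (1 + real n) * h"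
        using h unfolding e_def distrib_right mult_1 by linarith+
    qed
    have yn: "y ^ n / fact n \<le> (T + 1) ^ n"
    proof -
      have "y ^ n / fact n \<le> y ^ n / 1" using h(4) fact_ge_1[of n] by (intro divide_left_mono) auto
      also have "\<dots> \<le> (T + 1) ^ n" using h by (auto intro!: power_mono)
      finally show ?thesis .
    qed
    have "real (Suc n) * \<bar>h ^ Suc n * real (k choose Suc n) - y ^ Suc n / fact (Suc n)\<bar>
        = \<bar>real (Suc n) * (h ^ Suc n * real (k choose Suc n)) - real (Suc n) * (y ^ Suc n / fact (Suc n))\<bar>"
      by (simp only: abs_mult abs_of_nat flip: right_diff_distrib)
    also have "\<dots> = \<bar>p * e - (y ^ n / fact n) * y\<bar>"
    proof -
      have "real (Suc n) * (y ^ Suc n / fact (Suc n)) = y ^ n / fact n * y"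
        by (simp add: fact_Suc del: of_nat_Suc)
      then show ?thesis unfolding rec by (simp only:)
    qed
    also have "\<dots> = \<bar>(p - y ^ n / fact n) * e + (y ^ n / fact n) * (e - y)\<bar>"
      by (simp add: left_diff_distrib right_diff_distrib)
    also have "\<dots> \<le> \<bar>p - y ^ n / fact n\<bar> * \<bar>e\<bar> + \<bar>y ^ n / fact n\<bar> * \<bar>e - y\<bar>"
      by (metis abs_mult abs_triangle_ineq)
    also have "\<dots> \<le> (K * h) * (T + real n) + (T + 1) ^ n * ((1 + real n) * h)"
      using pe e yn K(1) h assms by (intro add_mono mult_mono) auto
    also have "\<dots> = (K * (T + real n) + (T + 1) ^ n * (1 + real n)) * h"
      by (simp add: algebra_simps)
    finally have "real (Suc n) * \<bar>h ^ Suc n * real (k choose Suc n) - y ^ Suc n / fact (Suc n)\<bar>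
      \<le> (K * (T + real n) + (T + 1) ^ n * (1 + real n)) * h" .
    moreover have "\<bar>z\<bar> \<le> real (Suc n) * \<bar>z\<bar>" for z :: real
      using mult_right_mono[of 1 "real (Suc n)" "\<bar>z\<bar>"] by simp
    ultimately show "\<bar>h ^ Suc n * real (k choose Suc n) - y ^ Suc n / fact (Suc n)\<bar>
      \<le> (K * (T + real n) + (T + 1) ^ n * (1 + real n)) * h"
      using order_trans by blast
  qed (use K(1) assms in auto)
qed (auto intro!: exI[of _ 0])

section \<open>Convergence of the grid recursion\<close>

text \<open>
  The factor \<open>1 + k * h\<close> leaves room for the error to grow linearly in time, which absorbs the local
  errors of order \<open>h\<^sup>2\<close>. The hypothesis \<open>b \<le> c1 * (k * h)\<close> is \<open>x \<ge> 0\<close>.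
\<close>

definition walk_error_bounded :: "real \<Rightarrow> real \<Rightarrow> real \<Rightarrow> nat \<Rightarrow> real \<Rightarrow> bool" where
  "walk_error_bounded c1 c2 T n K \<longleftrightarrow> (\<forall>h k b up. 0 < h \<longrightarrow> h \<le> 1 \<longrightarrow> real k * h \<le> T \<longrightarrow>
     0 < b \<longrightarrow> b \<le> c1 * (real k * h) \<longrightarrow>
     \<bar>h ^ n * real (card (walks (c1 * h) (c2 * h) up n k b)) -
      barrier_poly (c2 / c1) (if up then 0 else 1) n
        ((c1 * (real k * h) - b) / (c1 + c2)) ((c2 * (real k * h) + b) / (c1 + c2))\<bar>
     \<le> K * h * (1 + real k * h))"

lemma walk_error_boundedD:
  assumes "walk_error_bounded c1 c2 T n K" "0 < h" "h \<le> 1" "real k * h \<le> T"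
     "0 < b" "b \<le> c1 * (real k * h)"
  shows "\<bar>h ^ n * real (card (walks (c1 * h) (c2 * h) True n k b)) -
      barrier_poly (c2 / c1) 0 n
        ((c1 * (real k * h) - b) / (c1 + c2)) ((c2 * (real k * h) + b) / (c1 + c2))\<bar>
     \<le> K * h * (1 + real k * h)"
   and "\<bar>h ^ n * real (card (walks (c1 * h) (c2 * h) False n k b)) -
      barrier_poly (c2 / c1) 1 n
        ((c1 * (real k * h) - b) / (c1 + c2)) ((c2 * (real k * h) + b) / (c1 + c2))\<bar>
     \<le> K * h * (1 + real k * h)"
  using assms(1)[unfolded walk_error_bounded_def, rule_format, OF assms(2-), of True]
    assms(1)[unfolded walk_error_bounded_def, rule_format, OF assms(2-), of False] by simp_all

lemma coordinates:
  fixes c1 c2 b t :: real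
  assumes "c1 > 0" "c2 > 0"
  shows "(c1 * t - b) / (c1 + c2) + (c2 * t + b) / (c1 + c2) = t"
    and "b \<le> c1 * t \<Longrightarrow> (c1 * t - b) / (c1 + c2) \<ge> 0"
    and "b \<ge> 0 \<Longrightarrow> t \<ge> 0 \<Longrightarrow> (c2 * t + b) / (c1 + c2) \<ge> 0"
    and "b = c1 * ((c2 * t + b) / (c1 + c2)) - c2 * ((c1 * t - b) / (c1 + c2))"
proof -
  have "c1 + c2 > 0" using assms by simp
  then have "b = (b * (c1 + c2)) / (c1 + c2)" "t = (t * (c1 + c2)) / (c1 + c2)" by auto
  then show "(c1 * t - b) / (c1 + c2) + (c2 * t + b) / (c1 + c2) = t"
    and "b = c1 * ((c2 * t + b) / (c1 + c2)) - c2 * ((c1 * t - b) / (c1 + c2))"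
    by (simp_all add: algebra_simps flip: add_divide_distrib diff_divide_distrib)
qed (use assms in auto)

lemma one_step_error:
  fixes A1 A2 Q Q1 Q2 h t K K0 L :: real
  assumes "\<bar>A1 - Q1\<bar> \<le> K * h * (1 + t)" "\<bar>A2 - Q2\<bar> \<le> K0 * h * (1 + t)"
    and "\<bar>Q - Q1 - h * Q2\<bar> \<le> L * h\<^sup>2" and "K \<ge> (1 + T) * K0 + L" "t \<le> T" "h > 0" "K0 \<ge> 0"
  shows "\<bar>A1 + h * A2 - Q\<bar> \<le> K * h * (1 + (t + h))"
proof -
  have "\<bar>A1 + h * A2 - Q\<bar> \<le> \<bar>A1 - Q1\<bar> + h * \<bar>A2 - Q2\<bar> + \<bar>Q - Q1 - h * Q2\<bar>"
    using \<open>h > 0\<close> abs_mult[of h "A2 - Q2"] by (simp add: algebra_simps)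
  also have "\<dots> \<le> K * h * (1 + t) + h * (K0 * h * (1 + t)) + L * h\<^sup>2"
    using assms by (intro add_mono mult_left_mono) auto
  also have "\<dots> = K * h * (1 + t) + (K0 * (1 + t) + L) * h\<^sup>2"
    by (simp add: algebra_simps power2_eq_square)
  also have "\<dots> \<le> K * h * (1 + t) + K * h\<^sup>2"
  proof -
    have "K0 * (1 + t) \<le> (1 + T) * K0"
      using assms(5,7) by (simp add: mult.commute[of "1 + T"] mult_left_mono)
    then show ?thesis using assms(4) by (intro add_left_mono mult_right_mono) auto
  qed
  also have "\<dots> = K * h * (1 + (t + h))" by (simp add: algebra_simps power2_eq_square)
  finally show ?thesis .
qed

text \<open>
  Induction over the number of cells for a fixed number \<open>n\<close> of events, given the bound for \<open>n - 1\<close>.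
  Away from the boundary the first cell either has no event or has one, and both remaining walks are
  covered by the hypotheses. The recursion stops at the boundary, where the error has order \<open>h\<close> at once:
  an upward walk with \<open>b \<le> c1 * h\<close> hits the barrier in its first cell, while the polynomial is small
  because the line \<open>y = r * x\<close> is within distance \<open>h\<close>; a downward walk with \<open>x < h\<close> is unconstrained,
  while the polynomial is close to its value at \<open>x = 0\<close>.
\<close>

lemma walk_error_step:
  assumes c: "c1 > 0" "c2 > 0" and T: "T \<ge> 0" and K0: "K0 \<ge> 0"
    and prev: "\<And>n'. n = Suc n' \<Longrightarrow> walk_error_bounded c1 c2 T n' K0"
  shows "\<exists>K\<ge>0. walk_error_bounded c1 c2 T n K"
proof -
  obtain Kb where Kb: "Kb \<ge> 0" "\<And>h k y. 0 < h \<Longrightarrow> h \<le> 1 \<Longrightarrow> real k * h \<le> T \<Longrightarrow> 0 \<le> y \<Longrightarrow>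
     \<bar>real k * h - y\<bar> \<le> h \<Longrightarrow> \<bar>h ^ n * real (k choose n) - y ^ n / fact n\<bar> \<le> Kb * h"
    using binomial_power_approx[OF T, of n] by blast
  define r where "r = c2 / c1"
  define B where "B = slope_bound r T 1 n"
  define B' where "B' = slope_bound r T 0 n"
  define L where "L = slope_bound r T 2 (n - 1) + slope_bound r T (-1) (n - 1)"
  define K where "K = B + B' + Kb + L + (1 + T) * K0"
  have nonneg: "B \<ge> 0" "B' \<ge> 0" "slope_bound r T 2 (n - 1) \<ge> 0" "slope_bound r T (-1) (n - 1) \<ge> 0"
      "(1 + T) * K0 \<ge> 0"
    using T K0 by (auto simp: B_def B'_def slope_bound_nonneg)
  have K: "K \<ge> 0" "B \<le> K" "B' + Kb \<le> K" "(1 + T) * K0 + L \<le> K"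
    using nonneg Kb(1) by (auto simp: K_def L_def)
  have main: "b > 0 \<longrightarrow> b \<le> c1 * (real k * h) \<longrightarrow> real k * h \<le> T \<longrightarrow>
     \<bar>h ^ n * real (card (walks (c1 * h) (c2 * h) up n k b)) -
      barrier_poly r (if up then 0 else 1) n
        ((c1 * (real k * h) - b) / (c1 + c2)) ((c2 * (real k * h) + b) / (c1 + c2))\<bar>
     \<le> K * h * (1 + real k * h)" if h: "0 < h" "h \<le> 1" for h k b up
  proof (induction k arbitrary: b up)
    case (Suc k)
    show ?case
    proof (intro impI)
      assume b: "0 < b" "b \<le> c1 * (real (Suc k) * h)" and kT: "real (Suc k) * h \<le> T"
      define t where "t = real k * h"
      have t: "real (Suc k) * h = t + h" "t \<ge> 0" "t \<le> T" "t + h \<le> T"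
        using kT h by (auto simp: t_def algebra_simps)
      define x where "x = (c1 * (t + h) - b) / (c1 + c2)"
      define y where "y = (c2 * (t + h) + b) / (c1 + c2)"
      have xy: "x + y = t + h" "x \<ge> 0" "y \<ge> 0" "b = c1 * y - c2 * x"
        using coordinates[of c1 c2 "t + h" b] coordinates(4)[of c1 c2 b "t + h"] b c t h unfolding x_def y_def by auto
      note IH = Suc.IH[rule_format, folded t_def, unfolded t_def[symmetric]]
      have Kh: "C * h \<le> K * h * (1 + (t + h))" if "C \<le> K" for C
      proof -
        have "C * h \<le> K * h * 1" using that h by simp
        also have "\<dots> \<le> K * h * (1 + (t + h))" using K(1) h t by (intro mult_left_mono) auto
        finally show ?thesis .
      qed
      let ?W = "\<lambda>up n k b. real (card (walks (c1 * h) (c2 * h) up n k b))"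
      have "\<bar>h ^ n * ?W up n (Suc k) b - barrier_poly r (if up then 0 else 1) n x y\<bar>
              \<le> K * h * (1 + (t + h))"
      proof (cases up)
        case True
        show ?thesis
        proof (cases "b \<le> c1 * h")
          case small: True
          have W0: "?W True n (Suc k) b = 0"
            using small b by (auto simp: card_walks_Suc walks_empty split: nat.split)
          \<comment> \<open>The point \<open>(x, r * x)\<close> below \<open>(x, y)\<close> lies on the barrier line, at distance \<open>b / c1 \<le> h\<close>.\<close>
          have gap: "y - r * x = b / c1" using xy(4) c by (simp add: r_def field_simps)
          have "0 \<le> r * x" "0 \<le> b / c1" using xy(2) b c by (auto simp: r_def)
          with gap xy t have "\<bar>barrier_poly r 0 n x y - barrier_poly r 0 n x (r * x)\<bar> \<le> B * \<bar>y - r * x\<bar>"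
            unfolding B_def by (intro barrier_poly_lipschitz_y[where s = 0, simplified]) auto
          also note gap
          also have "B * \<bar>b / c1\<bar> \<le> B * h"
            using nonneg small b c by (intro mult_left_mono) (auto simp: field_simps)
          also have "\<dots> \<le> K * h * (1 + (t + h))" by (rule Kh) (rule K)
          finally show ?thesis using True W0 by (simp add: barrier_poly_diagonal)
        next
          case False
          define b' where "b' = b - c1 * h"
          have b': "0 < b'" "b' \<le> c1 * t" using False b t(1) by (auto simp: b'_def algebra_simps)
          have x': "(c1 * t - b') / (c1 + c2) = x" by (simp add: x_def b'_def algebra_simps)
          have y': "(c2 * t + b') / (c1 + c2) = y - h"
            using c by (simp add: y_def b'_def field_simps)
          have "y - h \<ge> 0" using y' b' t c by (metis add_nonneg_nonneg divide_nonneg_nonneg less_imp_le mult_nonneg_nonneg)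
          have E1: "\<bar>h ^ n * ?W True n k b' - barrier_poly r 0 n x (y - h)\<bar> \<le> K * h * (1 + t)"
            using IH[OF b' t(3), of True] by (simp add: x' y')
          show ?thesis
          proof (cases n)
            case 0
            have "?W True n (Suc k) b = ?W True n k b'"
              using b 0 by (simp add: card_walks_Suc b'_def)
            moreover have "\<bar>h ^ n * ?W True n k b' + h * 0 - barrier_poly r 0 n x y\<bar> \<le> K * h * (1 + (t + h))"
              by (rule one_step_error[OF E1, where ?A2.0 = 0 and ?Q2.0 = 0 and L = L and T = T and ?K0.0 = K0])
                (use K0 K h t T nonneg 0 in \<open>auto simp: L_def\<close>)
            ultimately show ?thesis using True by simp
          next
            case (Suc m)
            have E2: "\<bar>h ^ m * ?W False m k b' - barrier_poly r 1 m x (y - h)\<bar> \<le> K0 * h * (1 + t)"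
              using walk_error_boundedD(2)[OF prev[OF Suc] h _ b'(1), of k] b' t
              by (simp add: t_def[symmetric] x' y' flip: r_def)
            have "h ^ n * ?W True n (Suc k) b = h ^ n * ?W True n k b' + h * (h ^ m * ?W False m k b')"
              using b Suc by (simp add: card_walks_Suc b'_def algebra_simps)
            moreover have "\<bar>barrier_poly r 0 n x y - barrier_poly r 0 n x (y - h) - h * barrier_poly r 1 m x (y - h)\<bar>
                \<le> slope_bound r T 2 m * h\<^sup>2"
              using barrier_poly_taylor_y[of x T "y - h" h r 0 m] xy t h \<open>y - h \<ge> 0\<close> by (simp add: Suc)
            then have "\<bar>barrier_poly r 0 n x y - barrier_poly r 0 n x (y - h) - h * barrier_poly r 1 m x (y - h)\<bar>
                \<le> L * h\<^sup>2"
              by (rule order_trans) (use Suc nonneg in \<open>auto simp: L_def intro!: mult_right_mono\<close>)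
            from one_step_error[OF E1 E2 this K(4) t(3) h(1) K0]
            have "\<bar>h ^ n * ?W True n k b' + h * (h ^ m * ?W False m k b') - barrier_poly r 0 n x y\<bar> \<le> K * h * (1 + (t + h))" .
            ultimately show ?thesis using True by simp
          qed
        qed
      next
        case False
        show ?thesis
        proof (cases "x < h")
          case small: True
          \<comment> \<open>After the first, downward, cell even a straight ascent stays below the barrier.\<close>
          have W: "?W False n (Suc k) b = real (Suc k choose n)"
          proof -
            have "c1 * h * real k < b + c2 * h"
              using small c by (simp add: x_def t_def field_simps)
            then show ?thesis using b c h by (simp add: card_walks_unconstrained_down)
          qed
          have "\<bar>h ^ n * real (Suc k choose n) - y ^ n / fact n\<bar> \<le> Kb * h"
            using h kT xy small t by (intro Kb(2)) auto
          moreover have "\<bar>barrier_poly r 1 n x y - barrier_poly r 1 n 0 y\<bar> \<le> B' * \<bar>x - 0\<bar>"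
            unfolding B'_def using xy t h
            by (intro barrier_poly_lipschitz_x[where s = 1, simplified]) auto
          then have "\<bar>barrier_poly r 1 n x y - y ^ n / fact n\<bar> \<le> B' * h"
            using mult_left_mono[of x h B'] small xy nonneg by (simp add: barrier_poly_left)
          ultimately have "\<bar>h ^ n * real (Suc k choose n) - barrier_poly r 1 n x y\<bar> \<le> (B' + Kb) * h"
            by (simp add: algebra_simps)
          also have "\<dots> \<le> K * h * (1 + (t + h))" by (rule Kh) (rule K)
          finally show ?thesis using False W by simp
        next
          case big: False
          define b' where "b' = b + c2 * h"
          have b': "0 < b'" "b' \<le> c1 * t"
            using big c add_pos_pos[OF b(1) mult_pos_pos[OF c(2) h(1)]]
            by (auto simp: b'_def x_def field_simps)
          have x': "(c1 * t - b') / (c1 + c2) = x - h"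
            using c by (simp add: x_def b'_def field_simps)
          have y': "(c2 * t + b') / (c1 + c2) = y" by (simp add: y_def b'_def algebra_simps)
          have E1: "\<bar>h ^ n * ?W False n k b' - barrier_poly r 1 n (x - h) y\<bar> \<le> K * h * (1 + t)"
            using IH[OF b' t(3), of False] by (simp add: x' y')
          show ?thesis
          proof (cases n)
            case 0
            have "?W False n (Suc k) b = ?W False n k b'"
              using b 0 by (simp add: card_walks_Suc b'_def)
            moreover have "\<bar>h ^ n * ?W False n k b' + h * 0 - barrier_poly r 1 n x y\<bar> \<le> K * h * (1 + (t + h))"
              by (rule one_step_error[OF E1, where ?A2.0 = 0 and ?Q2.0 = 0 and L = L and T = T and ?K0.0 = K0])
                (use K0 K h t T nonneg 0 in \<open>auto simp: L_def\<close>)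
            ultimately show ?thesis using False by simp
          next
            case (Suc m)
            have E2: "\<bar>h ^ m * ?W True m k b' - barrier_poly r 0 m (x - h) y\<bar> \<le> K0 * h * (1 + t)"
              using walk_error_boundedD(1)[OF prev[OF Suc] h _ b'(1), of k] b' t
              by (simp add: t_def[symmetric] x' y' flip: r_def)
            have "h ^ n * ?W False n (Suc k) b = h ^ n * ?W False n k b' + h * (h ^ m * ?W True m k b')"
              using b Suc by (simp add: card_walks_Suc b'_def algebra_simps)
            moreover have "\<bar>barrier_poly r 1 n x y - barrier_poly r 1 n (x - h) y - h * barrier_poly r 0 m (x - h) y\<bar>
                \<le> slope_bound r T (-1) m * h\<^sup>2"
              using barrier_poly_taylor_x[of "x - h" h T y r 1 m] xy t h big by (simp add: Suc)
            then have "\<bar>barrier_poly r 1 n x y - barrier_poly r 1 n (x - h) y - h * barrier_poly r 0 m (x - h) y\<bar>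
                \<le> L * h\<^sup>2"
              by (rule order_trans) (use Suc nonneg in \<open>auto simp: L_def intro!: mult_right_mono\<close>)
            from one_step_error[OF E1 E2 this K(4) t(3) h(1) K0]
            have "\<bar>h ^ n * ?W False n k b' + h * (h ^ m * ?W True m k b') - barrier_poly r 1 n x y\<bar> \<le> K * h * (1 + (t + h))" .
            ultimately show ?thesis using False by simp
          qed
        qed
      qed
      then show "\<bar>h ^ n * ?W up n (Suc k) b - barrier_poly r (if up then 0 else 1) n
          ((c1 * (real (Suc k) * h) - b) / (c1 + c2)) ((c2 * (real (Suc k) * h) + b) / (c1 + c2))\<bar>
          \<le> K * h * (1 + real (Suc k) * h)"
        unfolding t x_def y_def .
    qed
  qed auto
  show ?thesis
    using main K(1) unfolding walk_error_bounded_def r_def by blast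
qed

lemma walk_error:
  assumes "c1 > 0" "c2 > 0" "T \<ge> 0"
  shows "\<exists>K\<ge>0. walk_error_bounded c1 c2 T n K"
proof (induction n)
  case 0
  show ?case by (rule walk_error_step[where ?K0.0 = 0]) (use assms in auto)
next
  case (Suc n)
  then obtain K where "K \<ge> 0" "walk_error_bounded c1 c2 T n K" by blast
  then show ?case using assms by (intro walk_error_step[where ?K0.0 = K]) auto
qed

lemma tendsto_0_if_abs_le:
  fixes f g :: "nat \<Rightarrow> real"
  assumes "\<forall>\<^sub>F p in sequentially. \<bar>f p\<bar> \<le> g p" "g \<longlonglongrightarrow> 0"
  shows "f \<longlonglongrightarrow> 0"
  by (rule Lim_null_comparison[OF _ assms(2)]) (use assms(1) in simp)

lemma tendsto_barrier_poly:
  assumes "(X \<longlongrightarrow> x) F" "(Y \<longlongrightarrow> y) F"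
  shows "((\<lambda>p. barrier_poly r s n (X p) (Y p)) \<longlongrightarrow> barrier_poly r s n x y) F"
  unfolding barrier_poly_def by (intro tendsto_intros assms) auto

text \<open>
  The barrier may move with the grid; this is what absorbs the distance between the grid maximum and the
  true maximum.
\<close>

lemma walk_count_limit:
  assumes "c1 > 0" "c2 > 0" "t > 0"
    and b: "\<beta> \<longlonglongrightarrow> b" "\<forall>\<^sub>F p in sequentially. 0 < \<beta> p \<and> \<beta> p \<le> c1 * t"
  shows "(\<lambda>p. (t / real (Suc p)) ^ n *
           real (card (walks (c1 * (t / real (Suc p))) (c2 * (t / real (Suc p))) True n (Suc p) (\<beta> p))))
         \<longlonglongrightarrow> barrier_poly (c2 / c1) 0 n ((c1 * t - b) / (c1 + c2)) ((c2 * t + b) / (c1 + c2))"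
proof -
  obtain K where K: "walk_error_bounded c1 c2 t n K"
    using walk_error[of c1 c2 t n] assms by auto
  define h where "h p = t / real (Suc p)" for p
  have h0: "h \<longlonglongrightarrow> 0" unfolding h_def by (rule LIMSEQ_Suc[OF lim_const_over_n])
  have h: "h p > 0" "real (Suc p) * h p = t" for p using \<open>t > 0\<close> by (auto simp: h_def)
  let ?Q = "\<lambda>b. barrier_poly (c2 / c1) 0 n ((c1 * t - b) / (c1 + c2)) ((c2 * t + b) / (c1 + c2))"
  let ?A = "\<lambda>p. h p ^ n * real (card (walks (c1 * h p) (c2 * h p) True n (Suc p) (\<beta> p)))"
  have "\<forall>\<^sub>F p in sequentially. h p < 1"
    using order_tendstoD(2)[OF h0, of 1] by simp
  with b(2) have "\<forall>\<^sub>F p in sequentially. \<bar>?A p - ?Q (\<beta> p)\<bar> \<le> K * h p * (1 + t)"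
  proof eventually_elim
    case (elim p)
    then show ?case using walk_error_boundedD(1)[OF K h(1), of p "Suc p" "\<beta> p"]
      by (simp add: h(2)[simplified])
  qed
  moreover have "(\<lambda>p. K * h p * (1 + t)) \<longlonglongrightarrow> 0"
    by (rule tendsto_mult_left_zero[OF tendsto_mult_right_zero[OF h0]])
  ultimately have "(\<lambda>p. ?A p - ?Q (\<beta> p)) \<longlonglongrightarrow> 0"
    by (rule tendsto_0_if_abs_le)
  moreover have "(\<lambda>p. ?Q (\<beta> p)) \<longlonglongrightarrow> ?Q b"
    using assms(1,2) by (intro tendsto_barrier_poly tendsto_intros b(1)) auto
  ultimately have "(\<lambda>p. (?A p - ?Q (\<beta> p)) + ?Q (\<beta> p)) \<longlonglongrightarrow> 0 + ?Q b"
    by (rule tendsto_add)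
  then show ?thesis by (simp add: h_def)
qed

lemma binomial_limit:
  assumes "t \<ge> 0"
  shows "(\<lambda>p. (t / real (Suc p)) ^ n * real (Suc p choose n)) \<longlonglongrightarrow> t ^ n / fact n"
proof (cases "t = 0")
  case False
  with assms have "t > 0" by simp
  obtain K where K: "\<And>h k y. 0 < h \<Longrightarrow> h \<le> 1 \<Longrightarrow> real k * h \<le> t \<Longrightarrow> 0 \<le> y \<Longrightarrow>
     \<bar>real k * h - y\<bar> \<le> h \<Longrightarrow> \<bar>h ^ n * real (k choose n) - y ^ n / fact n\<bar> \<le> K * h"
    using binomial_power_approx[OF assms, of n] by blast
  have h0: "(\<lambda>p. t / real (Suc p)) \<longlonglongrightarrow> 0" by (rule LIMSEQ_Suc[OF lim_const_over_n])
  have "\<forall>\<^sub>F p in sequentially. t / real (Suc p) < 1"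
    using order_tendstoD(2)[OF h0, of 1] by simp
  then have "\<forall>\<^sub>F p in sequentially.
      \<bar>(t / real (Suc p)) ^ n * real (Suc p choose n) - t ^ n / fact n\<bar> \<le> K * (t / real (Suc p))"
  proof eventually_elim
    case (elim p)
    then show ?case using \<open>t > 0\<close> by (intro K) auto
  qed
  moreover have "(\<lambda>p. K * (t / real (Suc p))) \<longlonglongrightarrow> 0"
    by (rule tendsto_mult_right_zero[OF h0])
  ultimately have "(\<lambda>p. (t / real (Suc p)) ^ n * real (Suc p choose n) - t ^ n / fact n) \<longlonglongrightarrow> 0"
    by (rule tendsto_0_if_abs_le)
  then show ?thesis by (rule LIM_zero_cancel)
next
  case True
  then show ?thesis by (cases n) simp_all
qed

section \<open>Paths and their grid approximations\<close>

definition path_velocity :: "real \<Rightarrow> real \<Rightarrow> (real \<Rightarrow> nat) \<Rightarrow> real \<Rightarrow> real" where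
  "path_velocity c1 c2 \<nu> s = (if even (\<nu> s) then c1 else - c2)"

definition path_position :: "real \<Rightarrow> real \<Rightarrow> (real \<Rightarrow> nat) \<Rightarrow> real \<Rightarrow> real" where
  "path_position c1 c2 \<nu> t = integral {0..t} (path_velocity c1 c2 \<nu>)"

definition path_max :: "real \<Rightarrow> real \<Rightarrow> (real \<Rightarrow> nat) \<Rightarrow> real \<Rightarrow> real" where
  "path_max c1 c2 \<nu> t = (SUP s\<in>{0..t}. path_position c1 c2 \<nu> s)"

definition grid_position :: "real \<Rightarrow> real \<Rightarrow> (real \<Rightarrow> nat) \<Rightarrow> real \<Rightarrow> nat \<Rightarrow> real" where
  "grid_position c1 c2 \<nu> h k = (\<Sum>i<k. h * path_velocity c1 c2 \<nu> (real i * h))"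

definition grid_max :: "real \<Rightarrow> real \<Rightarrow> (real \<Rightarrow> nat) \<Rightarrow> real \<Rightarrow> nat \<Rightarrow> real" where
  "grid_max c1 c2 \<nu> h m = Max (grid_position c1 c2 \<nu> h ` {..m})"

context
  fixes c1 c2 :: real and \<nu> :: "real \<Rightarrow> nat"
  assumes c: "c1 > 0" "c2 > 0" and mono: "mono_on {0..} \<nu>"
begin

lemma path_velocity_integrable:
  assumes "0 \<le> a"
  shows "path_velocity c1 c2 \<nu> integrable_on {a..b}"
proof -
  have "mono_on {a..b} (\<lambda>s. real (\<nu> s))"
    using mono assms by (auto simp: mono_on_def)
  then have "(\<lambda>s. real (\<nu> s)) \<in> borel_measurable (restrict_space borel {a..b})"
    by (rule borel_measurable_mono_on_fnc)
  then have "(\<lambda>s. nat \<lfloor>real (\<nu> s)\<rfloor>) \<in> restrict_space borel {a..b} \<rightarrow>\<^sub>M count_space UNIV"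
    by measurable
  then have "(\<lambda>s. if even (nat \<lfloor>real (\<nu> s)\<rfloor>) then c1 else - c2)
      \<in> borel_measurable (restrict_space borel {a..b})"
    by (rule measurable_compose[where g = "\<lambda>n. if even n then c1 else - c2"]) simp
  then have meas: "path_velocity c1 c2 \<nu> \<in> borel_measurable (restrict_space borel {a..b})"
    by (simp add: path_velocity_def[abs_def])
  have "set_integrable lborel {a..b} (path_velocity c1 c2 \<nu>)"
    unfolding set_integrable_def
  proof (rule integrableI_bounded_set[where A = "{a..b}" and B = "c1 + c2"])
    show "(\<lambda>s. indicat_real {a..b} s *\<^sub>R path_velocity c1 c2 \<nu> s) \<in> borel_measurable lborel"
      using meas by (simp add: borel_measurable_restrict_space_iff)
    show "emeasure lborel {a..b} < \<infinity>"
      by (cases "a \<le> b") auto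
  qed (use c in \<open>auto simp: path_velocity_def\<close>)
  then show ?thesis by (rule set_borel_integral_eq_integral)
qed

lemma path_position_diff:
  assumes "0 \<le> a" "a \<le> b"
  shows "path_position c1 c2 \<nu> b - path_position c1 c2 \<nu> a = integral {a..b} (path_velocity c1 c2 \<nu>)"
  using Henstock_Kurzweil_Integration.integral_combine[OF assms path_velocity_integrable[of 0 b]]
  by (simp add: path_position_def)

text \<open>
  The velocity at the left end is exact on an interval without events; otherwise the number of events is
  at least one and pays for the crude bound.
\<close>

lemma path_increment_approx:
  assumes "0 \<le> a" "a \<le> b"
  shows "\<bar>path_position c1 c2 \<nu> b - path_position c1 c2 \<nu> a - (b - a) * path_velocity c1 c2 \<nu> a\<bar>
           \<le> (c1 + c2) * (b - a) * (real (\<nu> b) - real (\<nu> a))"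
proof (cases "\<nu> a = \<nu> b")
  case True
  have "\<nu> s = \<nu> a" if "s \<in> {a..b}" for s
    using that assms mono_onD[OF mono, of a s] mono_onD[OF mono, of s b] True by auto
  then have "integral {a..b} (path_velocity c1 c2 \<nu>) = integral {a..b} (\<lambda>_. path_velocity c1 c2 \<nu> a)"
    by (intro Henstock_Kurzweil_Integration.integral_cong) (simp only: path_velocity_def)
  then show ?thesis
    using True assms by (simp add: path_position_diff)
next
  case False
  have "\<nu> a \<le> \<nu> b" using mono assms by (auto simp: mono_on_def)
  with False have jump: "real (\<nu> b) - real (\<nu> a) \<ge> 1" by linarith
  have "integral {a..b} (\<lambda>s. path_velocity c1 c2 \<nu> s - path_velocity c1 c2 \<nu> a)
      = integral {a..b} (path_velocity c1 c2 \<nu>) - (b - a) * path_velocity c1 c2 \<nu> a"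
    using assms by (subst Henstock_Kurzweil_Integration.integral_diff) (auto intro: path_velocity_integrable)
  moreover have "norm (integral {a..b} (\<lambda>s. path_velocity c1 c2 \<nu> s - path_velocity c1 c2 \<nu> a))
      \<le> integral {a..b} (\<lambda>_. c1 + c2)"
    using c assms by (intro integral_norm_bound_integral integrable_diff path_velocity_integrable)
      (auto simp: path_velocity_def)
  ultimately have "\<bar>path_position c1 c2 \<nu> b - path_position c1 c2 \<nu> a - (b - a) * path_velocity c1 c2 \<nu> a\<bar>
      \<le> (c1 + c2) * (b - a) * 1"
    using assms by (simp add: path_position_diff mult.commute)
  also have "\<dots> \<le> (c1 + c2) * (b - a) * (real (\<nu> b) - real (\<nu> a))"
    using jump c assms by (intro mult_left_mono) auto
  finally show ?thesis .
qed

lemma path_position_upper: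
  assumes "0 \<le> a" "a \<le> b"
  shows "path_position c1 c2 \<nu> b - path_position c1 c2 \<nu> a \<le> c1 * (b - a)"
proof -
  have "integral {a..b} (path_velocity c1 c2 \<nu>) \<le> integral {a..b} (\<lambda>_. c1)"
    using c assms by (intro integral_le path_velocity_integrable) (auto simp: path_velocity_def)
  then show ?thesis using assms by (simp add: path_position_diff mult.commute)
qed

lemma path_position_0: "path_position c1 c2 \<nu> 0 = 0"
  by (simp add: path_position_def)

lemma bdd_above_path_position: "bdd_above (path_position c1 c2 \<nu> ` {0..t})"
proof (rule bdd_aboveI2)
  fix s assume "s \<in> {0..t}"
  then have "path_position c1 c2 \<nu> s \<le> c1 * s" "c1 * s \<le> c1 * t"
    using path_position_upper[of 0 s] c by (auto simp: path_position_0)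
  then show "path_position c1 c2 \<nu> s \<le> c1 * t" by linarith
qed

lemma path_position_le_max: "s \<in> {0..t} \<Longrightarrow> path_position c1 c2 \<nu> s \<le> path_max c1 c2 \<nu> t"
  unfolding path_max_def by (rule cSUP_upper[OF _ bdd_above_path_position])

lemma path_max_nonneg: "t \<ge> 0 \<Longrightarrow> path_max c1 c2 \<nu> t \<ge> 0"
  using path_position_le_max[of 0 t] by (simp add: path_position_0)

lemma path_max_le: "t \<ge> 0 \<Longrightarrow> path_max c1 c2 \<nu> t \<le> c1 * t"
  unfolding path_max_def
proof (rule cSUP_least)
  fix s assume "s \<in> {0..t}"
  then have "path_position c1 c2 \<nu> s \<le> c1 * s" "c1 * s \<le> c1 * t"
    using path_position_upper[of 0 s] c by (auto simp: path_position_0)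
  then show "path_position c1 c2 \<nu> s \<le> c1 * t" by linarith
qed simp

lemma path_max_no_events:
  assumes "t \<ge> 0" "\<nu> t = 0"
  shows "path_max c1 c2 \<nu> t = c1 * t"
proof (rule antisym[OF path_max_le])
  have "\<nu> 0 = 0" using mono_onD[OF mono, of 0 t] assms by simp
  then have "path_position c1 c2 \<nu> t = c1 * t"
    using path_increment_approx[of 0 t] assms by (simp add: path_position_0 path_velocity_def mult.commute)
  then show "c1 * t \<le> path_max c1 c2 \<nu> t"
    using path_position_le_max[of t t] assms by simp
qed (use assms in simp)

lemma grid_position_approx:
  assumes "h > 0"
  shows "\<bar>path_position c1 c2 \<nu> (real k * h) - grid_position c1 c2 \<nu> h k\<bar>
           \<le> (c1 + c2) * h * (real (\<nu> (real k * h)) - real (\<nu> 0))"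
proof (induction k)
  case (Suc k)
  have eq: "real (Suc k) * h - real k * h = h" by (simp add: algebra_simps)
  have "\<bar>path_position c1 c2 \<nu> (real (Suc k) * h) - path_position c1 c2 \<nu> (real k * h)
           - h * path_velocity c1 c2 \<nu> (real k * h)\<bar>
      \<le> (c1 + c2) * h * (real (\<nu> (real (Suc k) * h)) - real (\<nu> (real k * h)))"
    using path_increment_approx[of "real k * h" "real (Suc k) * h"] assms unfolding eq
    by (simp add: mult_right_mono)
  moreover have "grid_position c1 c2 \<nu> h (Suc k) = grid_position c1 c2 \<nu> h k + h * path_velocity c1 c2 \<nu> (real k * h)"
    by (simp add: grid_position_def)
  ultimately show ?case
    using Suc.IH unfolding right_diff_distrib by linarith
qed (simp add: path_position_0 grid_position_def)

text \<open>
  The events contribute one cell length each, and one more is needed for the time between the maximising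
  instant and the grid point before it.
\<close>

lemma grid_max_approx:
  assumes h: "h > 0" "real m * h = t"
  shows "\<bar>path_max c1 c2 \<nu> t - grid_max c1 c2 \<nu> h m\<bar> \<le> (c1 + c2) * h * (real (\<nu> t) + 1)"
proof -
  let ?d = "(c1 + c2) * h"
  have t: "t \<ge> 0" using h by auto
  have grid: "\<bar>path_position c1 c2 \<nu> (real k * h) - grid_position c1 c2 \<nu> h k\<bar> \<le> ?d * real (\<nu> t)"
    if "k \<le> m" for k
  proof -
    have "real k * h \<le> t" using that h by (auto simp: mult_right_mono)
    then have "\<nu> (real k * h) \<le> \<nu> t"
      using h t by (intro mono_onD[OF mono]) auto
    then have "?d * (real (\<nu> (real k * h)) - real (\<nu> 0)) \<le> ?d * real (\<nu> t)"
      using c h by (intro mult_left_mono) auto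
    with grid_position_approx[OF h(1), of k] show ?thesis by linarith
  qed
  have grid_le: "grid_position c1 c2 \<nu> h k \<le> grid_max c1 c2 \<nu> h m" if "k \<le> m" for k
    unfolding grid_max_def using that by (intro Max_ge) auto
  have "grid_max c1 c2 \<nu> h m \<in> grid_position c1 c2 \<nu> h ` {..m}"
    unfolding grid_max_def by (intro Max_in) auto
  then obtain k where k: "k \<le> m" "grid_max c1 c2 \<nu> h m = grid_position c1 c2 \<nu> h k" by auto
  have "path_position c1 c2 \<nu> (real k * h) \<le> path_max c1 c2 \<nu> t"
    using k h by (intro path_position_le_max) (auto simp: mult_right_mono)
  with grid[OF k(1)] k(2) have lower: "grid_max c1 c2 \<nu> h m \<le> path_max c1 c2 \<nu> t + ?d * real (\<nu> t)"
    by linarith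
  have upper: "path_max c1 c2 \<nu> t \<le> grid_max c1 c2 \<nu> h m + ?d * real (\<nu> t) + ?d"
    unfolding path_max_def
  proof (rule cSUP_least)
    fix s assume s: "s \<in> {0..t}"
    define k where "k = nat \<lfloor>s / h\<rfloor>"
    have k: "real k * h \<le> s" "s \<le> real k * h + h"
    proof -
      have "real k \<le> s / h" "s / h \<le> real k + 1"
        using s h by (auto simp: k_def floor_le_iff)
      then show "real k * h \<le> s" "s \<le> real k * h + h"
        using h by (auto simp: field_simps)
    qed
    have "real k * h \<le> real m * h" using k s h(2) by simp
    then have km: "k \<le> m" using h(1) by simp
    have "path_position c1 c2 \<nu> s - path_position c1 c2 \<nu> (real k * h) \<le> c1 * (s - real k * h)"
      using k h by (intro path_position_upper) auto
    also have "\<dots> \<le> ?d" using k c h by (intro mult_mono) auto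
    finally show "path_position c1 c2 \<nu> s \<le> grid_max c1 c2 \<nu> h m + ?d * real (\<nu> t) + ?d"
      using grid[OF km] grid_le[OF km] by linarith
  qed (use t in simp)
  have "?d * (real (\<nu> t) + 1) = ?d * real (\<nu> t) + ?d" "?d \<ge> 0"
    using c h by (auto simp: algebra_simps)
  then show ?thesis using lower upper by linarith
qed

end

lemma grid_max_less_iff: "grid_max c1 c2 \<nu> h m < b \<longleftrightarrow> (\<forall>k\<le>m. grid_position c1 c2 \<nu> h k < b)"
  unfolding grid_max_def by (subst Max_less_iff) auto

section \<open>The Poisson process on a grid\<close>

lemma prod_nth_bool:
  "(\<Prod>i<length es. if es ! i then a * b else b) = b ^ length es * a ^ count_list es True" for a b :: real
  by (induction es) (auto simp: prod.lessThan_Suc_shift simp del: prod.lessThan_Suc)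

context poisson_process
begin

definition events_in_cell :: "real \<Rightarrow> nat \<Rightarrow> 'a \<Rightarrow> nat" where
  "events_in_cell h i \<omega> = N (real (Suc i) * h) \<omega> - N (real i * h) \<omega>"

text \<open>
  This is the \<open>\<sigma>\<close>-algebra that the model makes independent of the initial velocity.
\<close>

definition path_algebra :: "'a measure" where
  "path_algebra = vimage_algebra (space M) (\<lambda>\<omega>. \<lambda>t\<in>{0..}. N t \<omega>) (\<Pi>\<^sub>M t\<in>{0..}. count_space UNIV)"

lemma space_path_algebra [simp]: "space path_algebra = space M"
  by (simp add: path_algebra_def)

lemma measurable_N:
  assumes "s \<ge> 0" shows "N s \<in> path_algebra \<rightarrow>\<^sub>M count_space UNIV"
proof -
  have "(\<lambda>\<omega>. \<lambda>t\<in>{0..}. N t \<omega>) \<in> path_algebra \<rightarrow>\<^sub>M (\<Pi>\<^sub>M t\<in>{0..}. count_space UNIV)"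
    unfolding path_algebra_def by (rule measurable_vimage_algebra1) (auto simp: space_PiM)
  from measurable_compose[OF this measurable_component_singleton[of s]] show ?thesis
    using assms by simp
qed

lemma sets_path_algebra:
  assumes "A \<in> sets path_algebra"
  shows "A \<in> events"
proof -
  let ?f = "\<lambda>\<omega>. \<lambda>t\<in>{0..}. N t \<omega>" and ?P = "\<Pi>\<^sub>M t\<in>{0::real..}. count_space (UNIV :: nat set)"
  have f: "?f \<in> M \<rightarrow>\<^sub>M ?P"
    by (rule measurable_restrict) (use random_variable_N in auto)
  then have "sets path_algebra = {?f -` B \<inter> space M |B. B \<in> sets ?P}"
    unfolding path_algebra_def by (intro sets_vimage_algebra2) (auto dest: measurable_space)
  with assms obtain B where "A = ?f -` B \<inter> space M" "B \<in> sets ?P" by auto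
  with measurable_sets[OF f] show ?thesis by simp
qed

lemma N_le: "\<omega> \<in> space M \<Longrightarrow> 0 \<le> s \<Longrightarrow> s \<le> u \<Longrightarrow> N s \<omega> \<le> N u \<omega>"
  by (rule mono_onD[OF N_mono]) auto

lemma prob_events:
  assumes "t > 0"
  shows "prob {\<omega> \<in> space M. N t \<omega> = n} = exp (- l * t) * (l * t) ^ n / fact n"
proof -
  have "{\<omega> \<in> space M. N t \<omega> = n} = (\<lambda>\<omega>. N t \<omega> - N 0 \<omega>) -` {n} \<inter> space M"
    using N_zero by auto
  also have "prob \<dots> = measure (distr M (count_space UNIV) (\<lambda>\<omega>. N t \<omega> - N 0 \<omega>)) {n}"
    using random_variable_N[of t] random_variable_N[of 0] assms
    by (subst measure_distr) auto
  also have "\<dots> = pmf (poisson_pmf (l * t)) n"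
    using assms by (simp add: poisson_increments pmf.rep_eq)
  finally show ?thesis using assms rate_pos by (simp add: mult.commute)
qed

lemma indep_events_in_cells:
  assumes "h > 0"
  shows "indep_vars (\<lambda>_. count_space UNIV) (events_in_cell h) {..<m}"
proof -
  have "indep_vars (\<lambda>_. count_space UNIV) (\<lambda>i \<omega>. N (real (Suc i) * h) \<omega> - N (real i * h) \<omega>) {..<m}"
    using assms by (intro independent_increments) (auto simp: mono_on_def mult_right_mono)
  then show ?thesis by (simp add: events_in_cell_def[abs_def])
qed

lemma prob_events_in_cell:
  assumes "h > 0"
  shows "prob (events_in_cell h i -` {n} \<inter> space M) = exp (- l * h) * (l * h) ^ n / fact n"
proof -
  have m: "random_variable (count_space UNIV) (events_in_cell h i)"
    using indep_events_in_cells[OF assms, of "Suc i"] unfolding indep_vars_def by blast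
  have "prob (events_in_cell h i -` {n} \<inter> space M) = measure (distr M (count_space UNIV) (events_in_cell h i)) {n}"
    using m by (subst measure_distr) auto
  also have "distr M (count_space UNIV) (events_in_cell h i)
      = measure_pmf (poisson_pmf (l * (real (Suc i) * h - real i * h)))"
    unfolding events_in_cell_def[abs_def] using assms by (intro poisson_increments) auto
  also have "real (Suc i) * h - real i * h = h" by (simp add: algebra_simps)
  finally have "prob (events_in_cell h i -` {n} \<inter> space M) = pmf (poisson_pmf (l * h)) n"
    by (simp only: pmf.rep_eq)
  then show ?thesis using assms rate_pos by (simp add: mult.commute)
qed

definition cell_pattern :: "real \<Rightarrow> bool list \<Rightarrow> 'a set" where
  "cell_pattern h es = {\<omega> \<in> space M. \<forall>i<length es. events_in_cell h i \<omega> = of_bool (es ! i)}"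

text \<open>
  The probability depends on the pattern through the number of events alone, so that probabilities of
  grid events reduce to counting.
\<close>

lemma prob_cell_pattern:
  assumes "h > 0" "es \<noteq> []"
  shows "cell_pattern h es \<in> events"
    and "prob (cell_pattern h es) = exp (- l * (real (length es) * h)) * (l * h) ^ count_list es True"
proof -
  let ?X = "events_in_cell h" and ?m = "length es"
  note indep = indep_events_in_cells[OF assms(1), of ?m]
  have eq: "cell_pattern h es = (\<Inter>i\<in>{..<?m}. ?X i -` {of_bool (es ! i)} \<inter> space M)"
    using assms by (auto simp: cell_pattern_def)
  have "?X i \<in> M \<rightarrow>\<^sub>M count_space UNIV" if "i < ?m" for i
    using indep that by (auto simp: indep_vars_def)
  then have "?X i -` {of_bool (es ! i)} \<inter> space M \<in> events" if "i < ?m" for i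
    using that measurable_sets[of "?X i" M "count_space UNIV" "{of_bool (es ! i)}"] by simp
  then show "cell_pattern h es \<in> events"
    unfolding eq using assms by (intro sets.finite_INT) auto
  have "prob (cell_pattern h es) = (\<Prod>i<?m. prob (?X i -` {of_bool (es ! i)} \<inter> space M))"
    unfolding eq using assms by (intro indep_varsD[OF indep]) auto
  also have "\<dots> = (\<Prod>i<?m. if es ! i then (l * h) * exp (- l * h) else exp (- l * h))"
    using assms(1) by (intro prod.cong) (auto simp: prob_events_in_cell)
  also have "\<dots> = exp (- l * h) ^ ?m * (l * h) ^ count_list es True"
    by (rule prod_nth_bool)
  also have "exp (- l * h) ^ ?m = exp (- l * (real ?m * h))"
    by (simp add: exp_of_nat_mult[symmetric] mult_ac)
  finally show "prob (cell_pattern h es) = exp (- l * (real ?m * h)) * (l * h) ^ count_list es True" .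
qed

lemma cell_pattern_count:
  assumes "h > 0" "\<omega> \<in> cell_pattern h es" "k \<le> length es"
  shows "N (real k * h) \<omega> = count_list (take k es) True"
  using assms(3)
proof (induction k)
  case 0
  then show ?case using assms(2) N_zero by (simp add: cell_pattern_def)
next
  case (Suc k)
  have "N (real k * h) \<omega> \<le> N (real (Suc k) * h) \<omega>"
    using assms by (intro N_le) (auto simp: cell_pattern_def mult_right_mono)
  then have "N (real (Suc k) * h) \<omega> = N (real k * h) \<omega> + events_in_cell h k \<omega>"
    by (simp add: events_in_cell_def)
  also have "events_in_cell h k \<omega> = of_bool (es ! k)"
    using Suc.prems assms(2) by (simp add: cell_pattern_def)
  finally show ?case
    using Suc by (simp add: take_Suc_conv_app_nth)
qed

lemma cell_pattern_iff_walk: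
  assumes "h > 0" "\<omega> \<in> cell_pattern h es"
  shows "N (real (length es) * h) \<omega> = n \<and> grid_max c1 c2 (\<lambda>s. N s \<omega>) h (length es) < b \<longleftrightarrow>
           es \<in> walks (c1 * h) (c2 * h) True n (length es) b"
proof -
  have "grid_position c1 c2 (\<lambda>s. N s \<omega>) h k =
      (\<Sum>i<k. if even (count_list (take i es) True) = True then c1 * h else - (c2 * h))"
    if "k \<le> length es" for k
    unfolding grid_position_def path_velocity_def using that cell_pattern_count[OF assms]
    by (intro sum.cong) auto
  then show ?thesis
    using cell_pattern_count[OF assms, of "length es"]
    by (simp add: walks_def stays_below_iff grid_max_less_iff)
qed

text \<open>
  Grid events are restricted to outcomes without two events in a cell: only these correspond to lists of
  Booleans. The complement is shown to be negligible by comparing \<open>prob_sparse_unconstrained\<close> with the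
  Poisson probability of \<open>n\<close> events.
\<close>

definition sparse_event :: "real \<Rightarrow> real \<Rightarrow> real \<Rightarrow> nat \<Rightarrow> nat \<Rightarrow> real \<Rightarrow> 'a set" where
  "sparse_event c1 c2 h m n b = {\<omega> \<in> space M. (\<forall>i<m. events_in_cell h i \<omega> \<le> 1) \<and>
     N (real m * h) \<omega> = n \<and> grid_max c1 c2 (\<lambda>s. N s \<omega>) h m < b}"

lemma prob_sparse_event:
  assumes "h > 0" "m > 0"
  shows "sparse_event c1 c2 h m n b \<in> events"
    and "prob (sparse_event c1 c2 h m n b) =
           real (card (walks (c1 * h) (c2 * h) True n m b)) * (exp (- l * (real m * h)) * (l * h) ^ n)"
proof -
  let ?W = "walks (c1 * h) (c2 * h) True n m b"
  have len: "length es = m" "es \<noteq> []" "count_list es True = n" if "es \<in> ?W" for es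
    using that assms by (auto simp: walks_def)
  have eq: "sparse_event c1 c2 h m n b = (\<Union>es\<in>?W. cell_pattern h es)"
  proof (intro equalityI subsetI)
    fix \<omega> assume \<omega>: "\<omega> \<in> sparse_event c1 c2 h m n b"
    define es where "es = map (\<lambda>i. events_in_cell h i \<omega> = 1) [0..<m]"
    have l: "length es = m" by (simp add: es_def)
    have "events_in_cell h i \<omega> = of_bool (es ! i)" if "i < m" for i
    proof -
      have "events_in_cell h i \<omega> \<le> 1" using \<omega> that by (auto simp: sparse_event_def)
      then show ?thesis using that by (auto simp: es_def le_Suc_eq)
    qed
    with \<omega> l have p: "\<omega> \<in> cell_pattern h es" by (auto simp: cell_pattern_def sparse_event_def)
    with cell_pattern_iff_walk[OF assms(1) p, of n c1 c2 b] \<omega> l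
    show "\<omega> \<in> (\<Union>es\<in>?W. cell_pattern h es)" by (auto simp: sparse_event_def)
  next
    fix \<omega> assume "\<omega> \<in> (\<Union>es\<in>?W. cell_pattern h es)"
    then obtain es where es: "es \<in> ?W" "\<omega> \<in> cell_pattern h es" by auto
    with cell_pattern_iff_walk[OF assms(1) es(2), of n c1 c2 b] len[OF es(1)]
    show "\<omega> \<in> sparse_event c1 c2 h m n b"
      by (auto simp: sparse_event_def cell_pattern_def)
  qed
  have disj: "disjoint_family_on (cell_pattern h) ?W"
  proof (unfold disjoint_family_on_def, intro ballI impI)
    fix es es' assume W: "es \<in> ?W" "es' \<in> ?W" "es \<noteq> es'"
    show "cell_pattern h es \<inter> cell_pattern h es' = {}"
    proof (rule ccontr)
      assume "cell_pattern h es \<inter> cell_pattern h es' \<noteq> {}"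
      then have "\<forall>i<m. (of_bool (es ! i) :: nat) = of_bool (es' ! i)"
        using len(1)[OF W(1)] len(1)[OF W(2)] by (fastforce simp: cell_pattern_def)
      then have "\<forall>i<m. es ! i = es' ! i" by (simp add: of_bool_eq_iff)
      then have "es = es'"
        using len(1)[OF W(1)] len(1)[OF W(2)] by (intro nth_equalityI) auto
      with W(3) show False ..
    qed
  qed
  have ev: "cell_pattern h es \<in> events" if "es \<in> ?W" for es
    using prob_cell_pattern(1) assms(1) len(2) that by blast
  then show "sparse_event c1 c2 h m n b \<in> events"
    unfolding eq by (intro sets.finite_UN finite_walks) auto
  have "prob (sparse_event c1 c2 h m n b) = (\<Sum>es\<in>?W. prob (cell_pattern h es))"
    unfolding eq using ev by (intro finite_measure_finite_Union finite_walks disj) auto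
  also have "\<dots> = (\<Sum>es\<in>?W. exp (- l * (real m * h)) * (l * h) ^ n)"
    using len assms by (intro sum.cong) (auto simp: prob_cell_pattern)
  finally show "prob (sparse_event c1 c2 h m n b) =
           real (card ?W) * (exp (- l * (real m * h)) * (l * h) ^ n)" by simp
qed

lemma prob_sparse_unconstrained:
  fixes c1 c2 :: real
  assumes "h > 0" "m > 0" "c1 > 0" "c2 > 0"
  shows "prob {\<omega> \<in> space M. (\<forall>i<m. events_in_cell h i \<omega> \<le> 1) \<and> N (real m * h) \<omega> = n} =
           real (m choose n) * (exp (- l * (real m * h)) * (l * h) ^ n)"
    and "{\<omega> \<in> space M. (\<forall>i<m. events_in_cell h i \<omega> \<le> 1) \<and> N (real m * h) \<omega> = n} \<in> events"
proof -
  \<comment> \<open>Any barrier above the largest possible height \<open>c1 * h * m\<close> will do.\<close>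
  let ?b = "c1 * h * real m + 1"
  have "grid_max c1 c2 \<nu> h m < ?b" for \<nu>
    unfolding grid_max_less_iff
  proof (intro allI impI)
    fix k assume "k \<le> m"
    have "grid_position c1 c2 \<nu> h k \<le> (\<Sum>i<k. h * c1)"
      unfolding grid_position_def using assms
      by (intro sum_mono mult_left_mono) (auto simp: path_velocity_def)
    also have "\<dots> \<le> c1 * h * real m" using \<open>k \<le> m\<close> assms by simp
    finally show "grid_position c1 c2 \<nu> h k < ?b" by simp
  qed
  then have eq: "{\<omega> \<in> space M. (\<forall>i<m. events_in_cell h i \<omega> \<le> 1) \<and> N (real m * h) \<omega> = n}
      = sparse_event c1 c2 h m n ?b"
    by (auto simp: sparse_event_def)
  have "card (walks (c1 * h) (c2 * h) True n m ?b) = m choose n"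
    using assms by (intro card_walks_unconstrained) (auto intro: add_nonneg_pos)
  then show "prob {\<omega> \<in> space M. (\<forall>i<m. events_in_cell h i \<omega> \<le> 1) \<and> N (real m * h) \<omega> = n} =
           real (m choose n) * (exp (- l * (real m * h)) * (l * h) ^ n)"
    unfolding eq by (simp add: prob_sparse_event[OF assms(1,2)])
  show "{\<omega> \<in> space M. (\<forall>i<m. events_in_cell h i \<omega> \<le> 1) \<and> N (real m * h) \<omega> = n} \<in> events"
    unfolding eq by (rule prob_sparse_event(1)[OF assms(1,2)])
qed

section \<open>The distribution of the maximum for an upward start\<close>

context
  fixes c1 c2 t :: real
  assumes c: "c1 > 0" "c2 > 0" and t: "t > 0"
begin

text \<open>The maximum is the limit of the grid maxima, and these depend on finitely many values of \<open>N\<close>.\<close>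

lemma path_max_measurable [measurable]: "(\<lambda>\<omega>. path_max c1 c2 (\<lambda>s. N s \<omega>) t) \<in> borel_measurable path_algebra"
proof (rule borel_measurable_LIMSEQ_real)
  fix p :: nat
  let ?h = "t / real (Suc p)"
  have "(\<lambda>\<omega>. grid_position c1 c2 (\<lambda>s. N s \<omega>) ?h k) \<in> borel_measurable path_algebra" for k
    unfolding grid_position_def path_velocity_def
  proof (intro borel_measurable_sum borel_measurable_times borel_measurable_const)
    fix i
    have "N (real i * ?h) \<in> path_algebra \<rightarrow>\<^sub>M count_space UNIV"
      using t by (intro measurable_N) simp
    then show "(\<lambda>\<omega>. if even (N (real i * ?h) \<omega>) then c1 else - c2) \<in> borel_measurable path_algebra"
      by (rule measurable_compose[where g = "\<lambda>n. if even n then c1 else - c2"]) simp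
  qed
  then show "(\<lambda>\<omega>. grid_max c1 c2 (\<lambda>s. N s \<omega>) ?h (Suc p)) \<in> borel_measurable path_algebra"
    unfolding grid_max_def by (intro borel_measurable_Max) auto
next
  fix \<omega> assume "\<omega> \<in> space path_algebra"
  then have mono: "mono_on {0..} (\<lambda>s. N s \<omega>)" by (simp add: N_mono)
  have h0: "(\<lambda>p. t / real (Suc p)) \<longlonglongrightarrow> 0" by (rule LIMSEQ_Suc[OF lim_const_over_n])
  have "\<forall>\<^sub>F p in sequentially. \<bar>grid_max c1 c2 (\<lambda>s. N s \<omega>) (t / real (Suc p)) (Suc p) - path_max c1 c2 (\<lambda>s. N s \<omega>) t\<bar>
      \<le> (c1 + c2) * (t / real (Suc p)) * (real (N t \<omega>) + 1)"
    using grid_max_approx[OF c mono, of "t / real (Suc p)" "Suc p" t for p] t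
    by (subst abs_minus_commute) (intro always_eventually allI, simp)
  moreover have "(\<lambda>p. (c1 + c2) * (t / real (Suc p)) * (real (N t \<omega>) + 1)) \<longlonglongrightarrow> 0"
    by (rule tendsto_mult_left_zero[OF tendsto_mult_right_zero[OF h0]])
  ultimately have "(\<lambda>p. grid_max c1 c2 (\<lambda>s. N s \<omega>) (t / real (Suc p)) (Suc p) - path_max c1 c2 (\<lambda>s. N s \<omega>) t) \<longlonglongrightarrow> 0"
    by (rule tendsto_0_if_abs_le)
  then show "(\<lambda>p. grid_max c1 c2 (\<lambda>s. N s \<omega>) (t / real (Suc p)) (Suc p)) \<longlonglongrightarrow> path_max c1 c2 (\<lambda>s. N s \<omega>) t"
    by (rule LIM_zero_cancel)
qed

definition max_event :: "nat \<Rightarrow> real \<Rightarrow> 'a set" where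
  "max_event n b = {\<omega> \<in> space M. N t \<omega> = n \<and> path_max c1 c2 (\<lambda>s. N s \<omega>) t < b}"

lemma max_less_event: "{\<omega> \<in> space M. path_max c1 c2 (\<lambda>s. N s \<omega>) t < b} \<in> sets path_algebra"
proof -
  have "{\<omega> \<in> space path_algebra. path_max c1 c2 (\<lambda>s. N s \<omega>) t < b} \<in> sets path_algebra"
    by measurable
  then show ?thesis by simp
qed

lemma max_eq_event: "{\<omega> \<in> space M. path_max c1 c2 (\<lambda>s. N s \<omega>) t = b} \<in> sets path_algebra"
proof -
  have "{\<omega> \<in> space path_algebra. path_max c1 c2 (\<lambda>s. N s \<omega>) t = b} \<in> sets path_algebra"
    by measurable
  then show ?thesis by simp
qed

lemma N_event: "{\<omega> \<in> space M. N t \<omega> = n} \<in> events"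
proof -
  have "N t -` {n} \<inter> space M \<in> events"
    using measurable_sets[OF random_variable_N[of t], of "{n}"] t by simp
  also have "N t -` {n} \<inter> space M = {\<omega> \<in> space M. N t \<omega> = n}" by auto
  finally show ?thesis .
qed

lemma max_event_measurable: "max_event n b \<in> events"
proof -
  have "max_event n b = {\<omega> \<in> space M. N t \<omega> = n} \<inter> {\<omega> \<in> space M. path_max c1 c2 (\<lambda>s. N s \<omega>) t < b}"
    by (auto simp: max_event_def)
  then show ?thesis using N_event sets_path_algebra[OF max_less_event] by auto
qed

text \<open>
  For \<open>n\<close> events the maxima differ by at most \<open>\<delta> p\<close>, so the probability lies between the grid
  probabilities for the barriers \<open>b - \<delta> p\<close> and \<open>b + \<delta> p\<close>, up to the probability that some cell
  has two or more events. Both converge to the same value because the polynomial is continuous. At \<open>b = c1 * t\<close> the upper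
  barrier leaves the domain of \<open>walk_count_limit\<close>; there the value is the whole probability of \<open>n\<close>
  events if \<open>n > 0\<close>, and \<open>0\<close> if \<open>n = 0\<close> since a path without events reaches \<open>c1 * t\<close>.
\<close>

lemma prob_max_event:
  assumes "0 \<le> b" "b \<le> c1 * t"
  shows "prob (max_event n b) = exp (- l * t) * l ^ n *
           barrier_poly (c2 / c1) 0 n ((c1 * t - b) / (c1 + c2)) ((c2 * t + b) / (c1 + c2))"
    (is "_ = ?e * ?q b")
proof -
  define h where "h p = t / real (Suc p)" for p
  define \<delta> where "\<delta> p = (c1 + c2) * h p * (real n + 1)" for p
  have h: "h p > 0" "real (Suc p) * h p = t" for p using t by (auto simp: h_def)
  have \<delta>0: "\<delta> \<longlonglongrightarrow> 0"
    unfolding \<delta>_def h_def by (rule tendsto_mult_left_zero[OF tendsto_mult_right_zero[OF LIMSEQ_Suc[OF lim_const_over_n]]])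
  have \<delta>: "\<delta> p > 0" for p using c h(1)[of p] by (simp add: \<delta>_def)
  have near: "\<bar>path_max c1 c2 (\<lambda>s. N s \<omega>) t - grid_max c1 c2 (\<lambda>s. N s \<omega>) (h p) (Suc p)\<bar> \<le> \<delta> p"
    if "\<omega> \<in> space M" "N t \<omega> = n" for \<omega> p
    using grid_max_approx[OF c N_mono[OF that(1)] h(1) h(2), of p] that(2) by (simp add: \<delta>_def)
  let ?G = "\<lambda>p b. sparse_event c1 c2 (h p) (Suc p) n b"
  have G: "(\<lambda>p. prob (?G p (\<beta> p))) \<longlonglongrightarrow> ?e * ?q b"
    if "\<beta> \<longlonglongrightarrow> b" "\<forall>\<^sub>F p in sequentially. 0 < \<beta> p \<and> \<beta> p \<le> c1 * t" for \<beta>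
  proof -
    have "(\<lambda>p. ?e * (h p ^ n * real (card (walks (c1 * h p) (c2 * h p) True n (Suc p) (\<beta> p))))) \<longlonglongrightarrow> ?e * ?q b"
      unfolding h_def by (intro tendsto_mult_left walk_count_limit c t that)
    moreover have "prob (?G p (\<beta> p)) = ?e * (h p ^ n * real (card (walks (c1 * h p) (c2 * h p) True n (Suc p) (\<beta> p))))" for p
      using prob_sparse_event(2)[OF h(1)[of p], of "Suc p"] unfolding h(2)
      by (simp add: power_mult_distrib del: of_nat_Suc)
    ultimately show ?thesis by simp
  qed
  show ?thesis
  proof (cases "b = 0")
    case True
    then have "max_event n b = {}"
      using path_max_nonneg[OF c N_mono, of _ t] t by (fastforce simp: max_event_def)
    moreover have "?q b = 0"
      using barrier_poly_diagonal[of "c2 / c1" n "c1 * t / (c1 + c2)"] c True by simp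
    ultimately show ?thesis by simp
  next
    case False
    with assms have b: "b > 0" by simp
    have "(\<lambda>p. b - \<delta> p) \<longlonglongrightarrow> b - 0" by (intro tendsto_intros \<delta>0)
    then have lim: "(\<lambda>p. b - \<delta> p) \<longlonglongrightarrow> b" by simp
    have "\<forall>\<^sub>F p in sequentially. 0 < b - \<delta> p \<and> b - \<delta> p \<le> c1 * t"
      using order_tendstoD(1)[OF lim b] by eventually_elim (use assms(2) \<delta> in \<open>smt (verit)\<close>)
    from G[OF lim this] have lower: "?e * ?q b \<le> prob (max_event n b)"
    proof (rule LIMSEQ_le_const2, intro exI allI impI)
      fix p
      have "?G p (b - \<delta> p) \<subseteq> max_event n b"
      proof
        fix \<omega> assume "\<omega> \<in> ?G p (b - \<delta> p)"
        then have \<omega>: "\<omega> \<in> space M" "N t \<omega> = n" "grid_max c1 c2 (\<lambda>s. N s \<omega>) (h p) (Suc p) < b - \<delta> p"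
          unfolding sparse_event_def h(2) by auto
        with near[OF \<omega>(1,2), of p] show "\<omega> \<in> max_event n b"
          unfolding max_event_def by (simp add: abs_le_iff)
      qed
      then show "prob (?G p (b - \<delta> p)) \<le> prob (max_event n b)"
        by (intro finite_measure_mono max_event_measurable)
    qed
    have upper: "prob (max_event n b) \<le> ?e * ?q b"
    proof (cases "b = c1 * t")
      case endpoint: True
      have q: "?q b = barrier_poly (c2 / c1) 0 n 0 t"
        using c by (simp add: endpoint flip: distrib_right) (simp add: add.commute)
      show ?thesis
      proof (cases "n = 0")
        case True
        then have "max_event n b = {}"
          using path_max_no_events[OF c N_mono, of _ t] t by (auto simp: max_event_def endpoint)
        then show ?thesis using True q by (simp add: weight_def)
      next
        case False
        have "prob (max_event n b) \<le> prob {\<omega> \<in> space M. N t \<omega> = n}"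
          by (intro finite_measure_mono N_event) (auto simp: max_event_def)
        also have "\<dots> = ?e * ?q b"
          using False t by (simp add: q barrier_poly_left_0 prob_events power_mult_distrib)
        finally show ?thesis .
      qed
    next
      case False
      with assms have b1: "b < c1 * t" by simp
      let ?A = "\<lambda>p. {\<omega> \<in> space M. (\<forall>i<Suc p. events_in_cell (h p) i \<omega> \<le> 1) \<and> N t \<omega> = n}"
      let ?N = "{\<omega> \<in> space M. N t \<omega> = n}"
      have "(\<lambda>p. b + \<delta> p) \<longlonglongrightarrow> b + 0" by (intro tendsto_intros \<delta>0)
      then have lim: "(\<lambda>p. b + \<delta> p) \<longlonglongrightarrow> b" by simp
      have "\<forall>\<^sub>F p in sequentially. 0 < b + \<delta> p \<and> b + \<delta> p \<le> c1 * t"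
        using order_tendstoD(2)[OF lim b1] by eventually_elim (use b \<delta> in \<open>auto intro: add_pos_pos\<close>)
      from G[OF lim this] have limG: "(\<lambda>p. prob (?G p (b + \<delta> p))) \<longlonglongrightarrow> ?e * ?q b" .
      have A: "?A p \<in> events" "prob (?A p) = ?e * (h p ^ n * real (Suc p choose n))" for p
      proof -
        note * = prob_sparse_unconstrained[where h = "h p" and m = "Suc p" and n = n,
            OF h(1) zero_less_Suc c, unfolded h(2)]
        show "?A p \<in> events" by (rule *(2))
        show "prob (?A p) = ?e * (h p ^ n * real (Suc p choose n))"
          unfolding *(1) power_mult_distrib by (simp only: mult_ac)
      qed
      have "(\<lambda>p. prob (?A p)) \<longlonglongrightarrow> ?e * (t ^ n / fact n)"
        unfolding A(2) unfolding h_def by (intro tendsto_mult_left binomial_limit) (use t in simp)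
      also have "?e * (t ^ n / fact n) = prob ?N"
        using t by (simp add: prob_events power_mult_distrib)
      finally have "(\<lambda>p. prob (?G p (b + \<delta> p)) + (prob ?N - prob (?A p))) \<longlonglongrightarrow> ?e * ?q b + (prob ?N - prob ?N)"
        by (intro tendsto_intros limG)
      then have "(\<lambda>p. prob (?G p (b + \<delta> p)) + (prob ?N - prob (?A p))) \<longlonglongrightarrow> ?e * ?q b" by simp
      then show ?thesis
      proof (rule LIMSEQ_le_const, intro exI allI impI)
        fix p
        have sub: "max_event n b \<subseteq> ?G p (b + \<delta> p) \<union> (?N - ?A p)"
        proof
          fix \<omega> assume "\<omega> \<in> max_event n b"
          then have \<omega>: "\<omega> \<in> space M" "N t \<omega> = n" "path_max c1 c2 (\<lambda>s. N s \<omega>) t < b"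
            unfolding max_event_def by auto
          with near[OF \<omega>(1,2), of p] show "\<omega> \<in> ?G p (b + \<delta> p) \<union> (?N - ?A p)"
            unfolding sparse_event_def h(2) by (auto simp: abs_le_iff)
        qed
        have ev: "?G p (b + \<delta> p) \<in> events" by (intro prob_sparse_event h) simp
        have "prob (max_event n b) \<le> prob (?G p (b + \<delta> p) \<union> (?N - ?A p))"
          by (rule finite_measure_mono[OF sub]) (intro sets.Un sets.Diff ev A(1) N_event)
        also have "\<dots> \<le> prob (?G p (b + \<delta> p)) + prob (?N - ?A p)"
          by (intro measure_Un_le sets.Diff ev A(1) N_event)
        also have "prob (?N - ?A p) = prob ?N - prob (?A p)"
          by (rule finite_measure_Diff[OF N_event A(1)]) blast
        finally show "prob (max_event n b) \<le> prob (?G p (b + \<delta> p)) + (prob ?N - prob (?A p))" .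
      qed
    qed
    from lower upper show ?thesis by simp
  qed
qed

lemma path_max_distribution:
  assumes "0 \<le> b" "b \<le> c1 * t"
  shows "(\<lambda>n. exp (- l * t) * l ^ n *
           barrier_poly (c2 / c1) 0 n ((c1 * t - b) / (c1 + c2)) ((c2 * t + b) / (c1 + c2)))
         sums prob {\<omega> \<in> space M. path_max c1 c2 (\<lambda>s. N s \<omega>) t < b}"
proof -
  have "(\<lambda>n. prob (max_event n b)) sums prob (\<Union>n. max_event n b)"
    by (intro finite_measure_UNION) (auto simp: disjoint_family_on_def max_event_def max_event_measurable[unfolded max_event_def])
  also have "(\<Union>n. max_event n b) = {\<omega> \<in> space M. path_max c1 c2 (\<lambda>s. N s \<omega>) t < b}"
    by (auto simp: max_event_def)
  finally show ?thesis by (simp only: prob_max_event[OF assms])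
qed

text \<open>
  At the end point every weight with \<open>n > 0\<close> is the full Poisson weight, and the term \<open>n = 0\<close> is
  missing.
\<close>

lemma prob_path_max_less_end:
  "prob {\<omega> \<in> space M. path_max c1 c2 (\<lambda>s. N s \<omega>) t < c1 * t} = 1 - exp (- l * t)"
proof -
  have q: "(c1 * t - c1 * t) / (c1 + c2) = 0" "(c2 * t + c1 * t) / (c1 + c2) = t"
    using c by (simp_all add: add.commute flip: distrib_right)
  have "(\<lambda>n. exp (- l * t) * l ^ n * barrier_poly (c2 / c1) 0 n 0 t)
         sums prob {\<omega> \<in> space M. path_max c1 c2 (\<lambda>s. N s \<omega>) t < c1 * t}"
    using path_max_distribution[of "c1 * t"] c t unfolding q by simp
  moreover have "(\<lambda>n::nat. of_bool (n = 0) :: real) sums 1"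
    using sums_finite[of "{0}" "\<lambda>n::nat. of_bool (n = 0) :: real"] by simp
  then have "(\<lambda>n. exp (- l * t) * ((l * t) ^ n /\<^sub>R fact n - of_bool (n = 0)))
      sums (exp (- l * t) * (exp (l * t) - 1))"
    by (intro sums_mult sums_diff exp_converges)
  then have "(\<lambda>n. exp (- l * t) * l ^ n * barrier_poly (c2 / c1) 0 n 0 t) sums
      (exp (- l * t) * (exp (l * t) - 1))"
    by (rule sums_cong[THEN iffD1, rotated])
      (auto simp: barrier_poly_left_0 power_mult_distrib divide_inverse)
  ultimately have "prob {\<omega> \<in> space M. path_max c1 c2 (\<lambda>s. N s \<omega>) t < c1 * t} = exp (- l * t) * (exp (l * t) - 1)"
    by (rule sums_unique2)
  then show ?thesis by (simp add: right_diff_distrib flip: exp_add)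
qed

lemma prob_path_max_eq_end:
  "prob {\<omega> \<in> space M. path_max c1 c2 (\<lambda>s. N s \<omega>) t = c1 * t} = exp (- l * t)"
proof -
  let ?L = "{\<omega> \<in> space M. path_max c1 c2 (\<lambda>s. N s \<omega>) t < c1 * t}"
  have "{\<omega> \<in> space M. path_max c1 c2 (\<lambda>s. N s \<omega>) t = c1 * t} = space M - ?L"
    using path_max_le[OF c N_mono, of _ t] t by force
  then show ?thesis
    using prob_compl[OF sets_path_algebra[OF max_less_event]] prob_path_max_less_end by simp
qed

end

end

section \<open>Conditioning on the initial velocity\<close>

context asymmetric_telegraph
begin

lemma running_max_eq_path_max:
  assumes "V0 \<omega> = c1"
  shows "running_max c1 c2 N V0 t \<omega> = path_max c1 c2 (\<lambda>s. N s \<omega>) t"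
proof -
  have "velocity c1 c2 N V0 s \<omega> = path_velocity c1 c2 (\<lambda>s. N s \<omega>) s" for s
    using switch_velocity_funpow_even_odd[of c1 c1 c2 "N s \<omega>"] c1_pos c2_pos assms
    by (simp add: velocity_def path_velocity_def switch_velocity_def)
  then show ?thesis
    by (simp add: running_max_def path_max_def position_def path_position_def)
qed

text \<open>
  On \<open>V0 = c1\<close> the running maximum is a function of the events alone, which are independent of \<open>V0\<close>.
\<close>

lemma cond_prob_initial_up:
  assumes ev: "{\<omega> \<in> space M. P (path_max c1 c2 (\<lambda>s. N s \<omega>) t)} \<in> sets path_algebra"
  shows "\<P>(\<omega> in M. P (running_max c1 c2 N V0 t \<omega>) \<bar> V0 \<omega> = c1) =
           prob {\<omega> \<in> space M. P (path_max c1 c2 (\<lambda>s. N s \<omega>) t)}"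
proof -
  let ?V = "{\<omega> \<in> space M. V0 \<omega> = c1}"
  let ?P = "{\<omega> \<in> space M. P (path_max c1 c2 (\<lambda>s. N s \<omega>) t)}"
  have "V0 -` {c1} \<inter> space M \<in> sets (vimage_algebra (space M) V0 borel)"
    by (rule in_vimage_algebra) simp
  also have "V0 -` {c1} \<inter> space M = ?V" by auto
  finally have "prob (?V \<inter> ?P) = prob ?V * prob ?P"
    using initial_indep ev by (intro indep_setD) (auto simp: path_algebra_def)
  moreover have "{\<omega> \<in> space M. P (running_max c1 c2 N V0 t \<omega>) \<and> V0 \<omega> = c1} = ?V \<inter> ?P"
    using running_max_eq_path_max[of _ t] by (intro set_eqI) (simp, metis)
  ultimately show ?thesis
    by (simp add: cond_prob_def prob_V0_c1)
qed

end

section \<open>The Bessel series\<close>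

lemma weight_abs_le:
  assumes "r \<ge> 0"
  shows "\<bar>weight r (int k - int i)\<bar> \<le> (1 + r) ^ i"
proof -
  have "r ^ (i - k) \<le> (1 + r) ^ (i - k)" using assms by (intro power_mono) auto
  also have "\<dots> \<le> (1 + r) ^ i" using assms by (intro power_increasing) auto
  finally have "r ^ (i - k) \<le> (1 + r) ^ i" .
  moreover have "1 \<le> (1 + r) ^ i" using assms by (intro one_le_power) auto
  moreover have "nat (int i - int k) = i - k" by simp
  ultimately show ?thesis using assms by (simp add: weight_def)
qed

lemma exp_has_sum: "((\<lambda>n. x ^ n / fact n) has_sum exp x) UNIV" for x :: real
proof -
  have "(\<lambda>n. x ^ n / fact n) sums exp x"
    using exp_converges[of x] by (simp add: divide_inverse mult.commute)
  moreover have "summable (\<lambda>n. norm (x ^ n / fact n))"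
    using summable_norm_exp[of x] by (simp add: divide_inverse mult.commute)
  ultimately show ?thesis by (intro norm_summable_imp_has_sum)
qed

lemma barrier_series_summable:
  assumes "r \<ge> 0" "X \<ge> 0" "Y \<ge> 0"
  shows "(\<lambda>(i, k). weight r (int k - int i) * (X ^ i / fact i) * (Y ^ k / fact k)) summable_on A"
proof -
  let ?u = "\<lambda>(i, k). weight r (int k - int i) * (X ^ i / fact i) * (Y ^ k / fact k)"
  let ?v = "\<lambda>(i, k). ((1 + r) * X) ^ i / fact i * (Y ^ k / fact k)"
  have "?v summable_on (UNIV \<times> UNIV)"
  proof (rule summable_on_SigmaI)
    show "((\<lambda>k. ?v (i, k)) has_sum (((1 + r) * X) ^ i / fact i * exp Y)) UNIV" for i
      using has_sum_cmult_right[OF exp_has_sum, of "((1 + r) * X) ^ i / fact i" Y] by simp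
    show "(\<lambda>i. ((1 + r) * X) ^ i / fact i * exp Y) summable_on UNIV"
      by (rule summable_on_cmult_left[OF has_sum_imp_summable[OF exp_has_sum]])
  qed (use assms in auto)
  then have "?v summable_on UNIV" by simp
  then have "(\<lambda>z. norm (?u z)) summable_on UNIV"
  proof (rule Infinite_Sum.abs_summable_on_comparison_test', safe)
    fix i k
    have "\<bar>weight r (int k - int i)\<bar> * (X ^ i / fact i * (Y ^ k / fact k))
        \<le> (1 + r) ^ i * (X ^ i / fact i * (Y ^ k / fact k))"
      using assms by (intro mult_right_mono weight_abs_le) auto
    then show "norm (weight r (int k - int i) * (X ^ i / fact i) * (Y ^ k / fact k))
        \<le> ((1 + r) * X) ^ i / fact i * (Y ^ k / fact k)"
      using assms by (simp add: abs_mult power_mult_distrib mult_ac)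
  qed
  then have "?u summable_on UNIV" by (rule abs_summable_summable)
  then show ?thesis by (rule summable_on_subset) simp
qed

text \<open>
  The entire function with \<open>I_r (2 * s) = s ^ r * reduced_bessel r (s\<^sup>2)\<close>. With it the square roots of the
  series terms disappear, and the terms extend continuously to \<open>x = 0\<close>.
\<close>

definition reduced_bessel :: "nat \<Rightarrow> real \<Rightarrow> real" where
  "reduced_bessel r z = (\<Sum>j. 1 / (fact j * fact (j + r)) * z ^ j)"

lemma reduced_bessel_norm_summable: "summable (\<lambda>j. norm (1 / (fact j * fact (j + r)) * z ^ j :: real))"
proof (rule summable_comparison_test'[where N = 0, OF summable_norm_exp[of z]])
  fix j :: nat
  have "1 / (fact j * fact (j + r)) * \<bar>z\<bar> ^ j \<le> 1 / (fact j * 1) * \<bar>z\<bar> ^ j"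
    by (intro mult_right_mono divide_left_mono mult_left_mono) auto
  moreover have "norm (z ^ j /\<^sub>R fact j) = 1 / (fact j * 1) * \<bar>z\<bar> ^ j"
    by (simp add: abs_mult power_abs divide_inverse)
  moreover have "norm (norm (1 / (fact j * fact (j + r)) * z ^ j)) = 1 / (fact j * fact (j + r)) * \<bar>z\<bar> ^ j"
    by (simp add: abs_mult power_abs)
  ultimately show "norm (norm (1 / (fact j * fact (j + r)) * z ^ j)) \<le> norm (z ^ j /\<^sub>R fact j)"
    by simp
qed

lemma reduced_bessel_sums:
  "(\<lambda>j. 1 / (fact j * fact (j + r)) * z ^ j) sums reduced_bessel r z"
  unfolding reduced_bessel_def
  by (rule summable_sums[OF summable_norm_cancel[OF reduced_bessel_norm_summable]])

lemma reduced_bessel_has_sum: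
  "((\<lambda>j. 1 / (fact j * fact (j + r)) * z ^ j) has_sum reduced_bessel r z) UNIV"
  by (rule norm_summable_imp_has_sum[OF reduced_bessel_norm_summable reduced_bessel_sums])

lemma isCont_reduced_bessel: "isCont (reduced_bessel r) z"
proof -
  have "isCont (\<lambda>z. \<Sum>j. 1 / (fact j * fact (j + r)) * z ^ j) z"
    by (rule isCont_powser_converges_everywhere[OF summable_norm_cancel[OF reduced_bessel_norm_summable]])
  then show ?thesis by (simp add: reduced_bessel_def[abs_def])
qed

text \<open>
  Both series sum the absolutely convergent family of the terms
  \<open>weight r (k - i) * (X ^ i / i!) * (Y ^ k / k!)\<close> over all pairs \<open>(i, k)\<close>: the first along the
  antidiagonals \<open>i + k = n\<close>, the second along the diagonals \<open>k - i = \<plusminus> (m + 1)\<close>. The main diagonal has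
  weight \<open>0\<close>.
\<close>

lemma barrier_series_rearranged:
  assumes "r \<ge> 0" "X \<ge> 0" "Y \<ge> 0"
  obtains S where "(\<lambda>n. barrier_poly r 0 n X Y) sums S"
    and "(\<lambda>m. (Y ^ Suc m - (r * X) ^ Suc m) * reduced_bessel (Suc m) (X * Y)) sums S"
proof -
  define u where "u = (\<lambda>(i, k). weight r (int k - int i) * (X ^ i / fact i) * (Y ^ k / fact k))"
  have summ: "u summable_on A" for A
    unfolding u_def using assms by (rule barrier_series_summable)
  define U where "U = {(i, k). i < (k::nat)}"
  define L where "L = {(i, k). k < (i::nat)}"
  have U: "(u has_sum infsum u U) U" and L: "(u has_sum infsum u L) L"
    using summ by (auto intro: has_sum_infsum)
  define S where "S = infsum u U + infsum u L"
  have "(u has_sum S) (U \<union> L)"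
    unfolding S_def by (rule has_sum_Un_disjoint[OF U L]) (auto simp: U_def L_def)
  moreover have "(u has_sum S) (U \<union> L) \<longleftrightarrow> (u has_sum S) UNIV"
    by (rule has_sum_cong_neutral) (auto simp: U_def L_def u_def weight_def)
  ultimately have all: "(u has_sum S) UNIV" by simp
  have "((\<lambda>(n, i). u (i, n - i)) has_sum S) (Sigma UNIV (\<lambda>n. {..n}))"
    using all by (subst has_sum_reindex_bij_witness
        [where T = UNIV and h = u and j = "\<lambda>(n, i). (i, n - i)" and i = "\<lambda>(i, k). (i + k, i)"]) auto
  then have "((\<lambda>n. barrier_poly r 0 n X Y) has_sum S) UNIV"
  proof (rule has_sum_SigmaD)
    fix n :: nat
    have "barrier_poly r 0 n X Y = (\<Sum>i\<le>n. u (i, n - i))"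
      unfolding barrier_poly_def u_def by (intro sum.cong) (auto simp: of_nat_diff)
    then show "((\<lambda>i. (case (n, i) of (n, i) \<Rightarrow> u (i, n - i))) has_sum barrier_poly r 0 n X Y) {..n}"
      by (intro has_sum_finiteI) auto
  qed
  then have one: "(\<lambda>n. barrier_poly r 0 n X Y) sums S" by (rule has_sum_imp_sums)
  have "((\<lambda>(m, j). u (j, j + Suc m)) has_sum infsum u U) (UNIV \<times> UNIV)"
    using U by (subst has_sum_reindex_bij_witness
        [where T = U and h = u and j = "\<lambda>(m, j). (j, j + Suc m)" and i = "\<lambda>(i, k). (k - Suc i, i)"])
      (auto simp: U_def)
  then have up: "((\<lambda>m. Y ^ Suc m * reduced_bessel (Suc m) (X * Y)) has_sum infsum u U) UNIV"
  proof (rule has_sum_SigmaD)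
    fix m :: nat
    have "(case (m, j) of (m, j) \<Rightarrow> u (j, j + Suc m)) =
        Y ^ Suc m * (1 / (fact j * fact (j + Suc m)) * (X * Y) ^ j)" for j
      by (simp add: u_def weight_def power_mult_distrib power_add mult_ac del: fact_Suc)
    then show "((\<lambda>j. case (m, j) of (m, j) \<Rightarrow> u (j, j + Suc m)) has_sum
        Y ^ Suc m * reduced_bessel (Suc m) (X * Y)) UNIV"
      by (simp only: has_sum_cmult_right[OF reduced_bessel_has_sum])
  qed
  have "((\<lambda>(m, j). u (j + Suc m, j)) has_sum infsum u L) (UNIV \<times> UNIV)"
    using L by (subst has_sum_reindex_bij_witness
        [where T = L and h = u and j = "\<lambda>(m, j). (j + Suc m, j)" and i = "\<lambda>(i, k). (i - Suc k, k)"])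
      (auto simp: L_def)
  then have down: "((\<lambda>m. - ((r * X) ^ Suc m) * reduced_bessel (Suc m) (X * Y)) has_sum infsum u L) UNIV"
  proof (rule has_sum_SigmaD)
    fix m :: nat
    have "nat (int m + 1) = Suc m" by simp
    then have "(case (m, j) of (m, j) \<Rightarrow> u (j + Suc m, j)) =
        - ((r * X) ^ Suc m) * (1 / (fact j * fact (j + Suc m)) * (X * Y) ^ j)" for j
      by (simp add: u_def weight_def power_mult_distrib power_add mult_ac del: fact_Suc)
    then show "((\<lambda>j. case (m, j) of (m, j) \<Rightarrow> u (j + Suc m, j)) has_sum
        - ((r * X) ^ Suc m) * reduced_bessel (Suc m) (X * Y)) UNIV"
      by (simp only: has_sum_cmult_right[OF reduced_bessel_has_sum])
  qed
  have "((\<lambda>m. (Y ^ Suc m - (r * X) ^ Suc m) * reduced_bessel (Suc m) (X * Y)) has_sum S) UNIV"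
    using has_sum_add[OF up down] by (simp add: S_def left_diff_distrib)
  from that[OF one has_sum_imp_sums[OF this]] show ?thesis .
qed

lemma bessel_I_reduced:
  "bessel_I r (2 * s) = s ^ r * reduced_bessel r (s\<^sup>2)"
proof -
  have "Gamma (real (j + r + 1)) = fact (j + r)" for j
    using Gamma_fact[of "j + r", where 'a = real] by (simp add: add_ac)
  then have "(2 * s / 2) ^ (2 * j + r) * (1 / (fact j * Gamma (real (j + r + 1))))
      = s ^ r * (1 / (fact j * fact (j + r)) * (s\<^sup>2) ^ j)" for j
    by (simp only:) (simp add: power_add power_mult)
  then show ?thesis
    unfolding bessel_I_def
    by (simp only: sums_unique[OF sums_mult[OF reduced_bessel_sums], symmetric])
qed

lemma series_term_formula_eq:
  assumes c: "c1 > 0" "c2 > 0" "l > 0" and t: "t > 0" and b: "0 \<le> b" "b < c1 * t"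
  defines "x \<equiv> (c1 * t - b) / (c1 + c2)" and "y \<equiv> (c2 * t + b) / (c1 + c2)"
  shows "series_term_formula c1 c2 l t r b =
    ((l * y) ^ r - (c2 / c1 * (l * x)) ^ r) * reduced_bessel r ((l * x) * (l * y))"
proof -
  have cc: "c1 + c2 > 0" using c by simp
  have x: "x > 0" "c1 * t - b = (c1 + c2) * x" using b cc by (auto simp: x_def)
  have y: "y > 0" "c2 * t + b = (c1 + c2) * y"
    using b c t cc by (auto simp: y_def intro!: add_pos_nonneg divide_pos_pos)
  define s where "s = sqrt ((l * x) * (l * y))"
  have "(l * x) * (l * y) = l\<^sup>2 * (x * y)" by (simp only: power2_eq_square mult_ac)
  then have s: "s = l * (sqrt x * sqrt y)"
    using c by (simp add: s_def real_sqrt_mult)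
  have s2: "s\<^sup>2 = (l * x) * (l * y)"
    unfolding s_def by (rule real_sqrt_pow2) (use x y c in simp)
  have arg: "2 * l / (c1 + c2) * sqrt ((c1 * t - b) * (c2 * t + b)) = 2 * s"
  proof -
    have "(c1 * t - b) * (c2 * t + b) = (c1 + c2)\<^sup>2 * (x * y)"
      unfolding x(2) y(2) by (simp only: power2_eq_square mult_ac)
    then have "sqrt ((c1 * t - b) * (c2 * t + b)) = (c1 + c2) * (sqrt x * sqrt y)"
      using cc by (simp add: real_sqrt_mult)
    then show ?thesis using cc by (simp add: s)
  qed
  have "(c2 * t + b) / (c1 * t - b) = y / x" "(c1 * t - b) / (c2 * t + b) = x / y"
    unfolding x(2) y(2) using cc by simp_all
  moreover have "s * sqrt (y / x) = l * y" "s * (c2 / c1 * sqrt (x / y)) = c2 / c1 * (l * x)"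
    using x(1) y(1) by (simp_all add: s real_sqrt_divide)
  ultimately have "s ^ r * (sqrt ((c2 * t + b) / (c1 * t - b)) ^ r - (c2 / c1 * sqrt ((c1 * t - b) / (c2 * t + b))) ^ r)
     = (l * y) ^ r - (c2 / c1 * (l * x)) ^ r"
    by (simp only: right_diff_distrib flip: power_mult_distrib)
  from arg_cong[OF this, of "\<lambda>z. z * reduced_bessel r ((l * x) * (l * y))"] show ?thesis
    unfolding series_term_formula_def arg bessel_I_reduced s2 by (simp only: mult_ac)
qed

text \<open>
  The right-hand side is continuous in \<open>b\<close>, also at \<open>c1 * t\<close>, so it gives the limit that defines the term
  at the end point.
\<close>

lemma series_term_eq:
  assumes c: "c1 > 0" "c2 > 0" "l > 0" and t: "t > 0" and b: "0 \<le> b" "b \<le> c1 * t"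
  defines "x \<equiv> (c1 * t - b) / (c1 + c2)" and "y \<equiv> (c2 * t + b) / (c1 + c2)"
  shows "series_term c1 c2 l t r b =
    ((l * y) ^ r - (c2 / c1 * (l * x)) ^ r) * reduced_bessel r ((l * x) * (l * y))"
proof (cases "b = c1 * t")
  case False
  then show ?thesis using series_term_formula_eq[OF c t, of b r] b by (simp add: series_term_def x_def y_def)
next
  case True
  let ?x = "\<lambda>b. (c1 * t - b) / (c1 + c2)" and ?y = "\<lambda>b. (c2 * t + b) / (c1 + c2)"
  let ?f = "\<lambda>b. ((l * ?y b) ^ r - (c2 / c1 * (l * ?x b)) ^ r) * reduced_bessel r ((l * ?x b) * (l * ?y b))"
  have "isCont ?f b"
    using c by (intro continuous_intros isCont_o2[OF _ isCont_reduced_bessel]) auto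
  then have "(?f \<longlongrightarrow> ?f b) (at_left b)"
    unfolding isCont_def by (rule filterlim_mono) (auto simp: at_le)
  moreover have "\<forall>\<^sub>F z in at_left b. ?f z = series_term_formula c1 c2 l t r z"
  proof -
    have "0 < b" using True c t by simp
    then have "\<forall>\<^sub>F z in at_left b. z \<in> {0<..<b}" by (rule eventually_at_left_real)
    then show ?thesis
      by eventually_elim (use series_term_formula_eq[OF c t] True in auto)
  qed
  ultimately have "(series_term_formula c1 c2 l t r \<longlongrightarrow> ?f b) (at_left b)"
    by (rule Lim_transform_eventually)
  then have "Lim (at_left b) (series_term_formula c1 c2 l t r) = ?f b"
    by (intro tendsto_Lim) auto
  then show ?thesis unfolding series_term_def x_def y_def using True by (simp only: simp_thms if_True)
qed

lemma barrier_poly_scale: "barrier_poly r s n (l * x) (l * y) = l ^ n * barrier_poly r s n x y"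
proof -
  have "l ^ i * l ^ (n - i) = l ^ n" if "i \<le> n" for i
    using that by (simp flip: power_add)
  then have "w * ((l * x) ^ i / fact i) * ((l * y) ^ (n - i) / fact (n - i))
      = l ^ n * (w * (x ^ i / fact i) * (y ^ (n - i) / fact (n - i)))" if "i \<le> n" for w i
    using that[THEN \<open>\<And>i. i \<le> n \<Longrightarrow> l ^ i * l ^ (n - i) = l ^ n\<close>, symmetric]
    by (simp add: power_mult_distrib)
  then show ?thesis
    unfolding barrier_poly_def sum_distrib_left by (intro sum.cong refl) simp
qed

theorem theorem2p3:
  fixes M :: "'a measure" and N :: "real \<Rightarrow> 'a \<Rightarrow> nat" and V0 :: "'a \<Rightarrow> real"
    and c1 c2 l t :: real
  assumes "asymmetric_telegraph M N l V0 c1 c2" and "t > 0"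
  shows "(\<forall>\<beta>\<in>{0..c1 * t}.
           summable (\<lambda>k. series_term c1 c2 l t (Suc k) \<beta>) \<and>
           \<P>(\<omega> in M. running_max c1 c2 N V0 t \<omega> < \<beta> \<bar> V0 \<omega> = c1) =
             exp (- l * t) * (\<Sum>k. series_term c1 c2 l t (Suc k) \<beta>)) \<and>
         \<P>(\<omega> in M. running_max c1 c2 N V0 t \<omega> = c1 * t \<bar> V0 \<omega> = c1) = exp (- l * t)"
proof -
  interpret asymmetric_telegraph M N l V0 c1 c2 by fact
  note c = c1_pos c2_pos and t = \<open>t > 0\<close>
  have distribution: "summable (\<lambda>k. series_term c1 c2 l t (Suc k) \<beta>) \<and>
      \<P>(\<omega> in M. running_max c1 c2 N V0 t \<omega> < \<beta> \<bar> V0 \<omega> = c1) =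
        exp (- l * t) * (\<Sum>k. series_term c1 c2 l t (Suc k) \<beta>)" if \<beta>: "\<beta> \<in> {0..c1 * t}" for \<beta>
  proof -
    define x where "x = (c1 * t - \<beta>) / (c1 + c2)"
    define y where "y = (c2 * t + \<beta>) / (c1 + c2)"
    have xy: "l * x \<ge> 0" "l * y \<ge> 0"
      using \<beta> c t rate_pos by (auto simp: x_def y_def)
    obtain S where poly: "(\<lambda>n. barrier_poly (c2 / c1) 0 n (l * x) (l * y)) sums S"
      and bessel: "(\<lambda>m. ((l * y) ^ Suc m - (c2 / c1 * (l * x)) ^ Suc m) *
        reduced_bessel (Suc m) ((l * x) * (l * y))) sums S"
      using barrier_series_rearranged[of "c2 / c1" "l * x" "l * y"] xy c by auto
    have terms: "series_term c1 c2 l t (Suc m) \<beta> = ((l * y) ^ Suc m - (c2 / c1 * (l * x)) ^ Suc m) *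
        reduced_bessel (Suc m) ((l * x) * (l * y))" for m
      unfolding x_def y_def using \<beta> by (intro series_term_eq c t rate_pos) auto
    have series: "(\<lambda>k. series_term c1 c2 l t (Suc k) \<beta>) sums S"
      unfolding terms by (rule bessel)
    have "(\<lambda>n. exp (- l * t) * (l ^ n * barrier_poly (c2 / c1) 0 n x y)) sums (exp (- l * t) * S)"
      using sums_mult[OF poly[unfolded barrier_poly_scale]] .
    moreover have "(\<lambda>n. exp (- l * t) * (l ^ n * barrier_poly (c2 / c1) 0 n x y))
        sums prob {\<omega> \<in> space M. path_max c1 c2 (\<lambda>s. N s \<omega>) t < \<beta>}"
      using path_max_distribution[OF c t, of \<beta>] \<beta> by (simp only: x_def y_def mult.assoc atLeastAtMost_iff simp_thms)
    ultimately have "prob {\<omega> \<in> space M. path_max c1 c2 (\<lambda>s. N s \<omega>) t < \<beta>} = exp (- l * t) * S"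
      by (rule sums_unique2[symmetric])
    then have "\<P>(\<omega> in M. running_max c1 c2 N V0 t \<omega> < \<beta> \<bar> V0 \<omega> = c1) = exp (- l * t) * S"
      by (simp only: cond_prob_initial_up[where P = "\<lambda>m. m < \<beta>", OF max_less_event[OF c t]])
    then show ?thesis
      using series by (simp add: sums_iff)
  qed
  then have "\<forall>\<beta>\<in>{0..c1 * t}. summable (\<lambda>k. series_term c1 c2 l t (Suc k) \<beta>) \<and>
      \<P>(\<omega> in M. running_max c1 c2 N V0 t \<omega> < \<beta> \<bar> V0 \<omega> = c1) =
        exp (- l * t) * (\<Sum>k. series_term c1 c2 l t (Suc k) \<beta>)"
    by (rule ballI)
  moreover have "\<P>(\<omega> in M. running_max c1 c2 N V0 t \<omega> = c1 * t \<bar> V0 \<omega> = c1) = exp (- l * t)"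
    by (simp only: cond_prob_initial_up[where P = "\<lambda>m. m = c1 * t", OF max_eq_event[OF c t]]
        prob_path_max_eq_end[OF c t])
  ultimately show ?thesis by (rule conjI)
qed

end
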